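(* Let $(M,\mu)$ be a measured space belonging to one of the classes $(\mathscr C1)$, $(\mathscr C2)$, $(\mathscr C3)$ described in the context, with eigenvalues $\lambda_k(M)$. Let $\mathcal U=(U_v)_{v\in V}$ be a 2-fold cover of $M$, let $\mathcal L_{\mathcal U}$ be its associated discrete Laplacian, and let $\lambda_k(\mathcal L_{\mathcal U})$ denote its eigenvalues in nondecreasing order (indexed from $0$, with multiplicity). Let $\eta>0$ and assume that every $U_v$, $v\in V$, has Neumann value $\lambda(U_v)\ge\eta$. Then for all positive integers $k\le |V|-1$, $$\lambda_k(\mathcal L_{\mathcal U})\;\le\; 2\,\frac{\lambda_k(M)}{\eta}.$$
   Context: **2-fold covers.** A 2-fold cover of a measured topological space $(M,\mu)$ is a finite family $\mathcal U=(U_v)_{v\in V}$ of open subsets of $M$ of non-zero (finite) measure such that $\mu$-almost every point of $M$ belongs to $U_v$ for exactly two indices $v\in V$. **Associated discrete Laplacian.** Let $G=(V,E)$ be the graph with an edge $\{u,v\}$ for each pair $u\ne v$ with $\mu(U_u\cap U_v)\neq 0$, with weight $\omega(\{u,v\})=\mu(U_u\cap U_v)$. For $v\in V$ let $d_v^\omega=\sum_{u:u\sim v}\omega(\{u,v\})$. For $f:V\to\mathbb R$ put $\Delta_{\mathcal U}(f)(v)=\sum_{u:u\sim v}(f(v)-f(u))\,\omega(\{u,v\})$ and $S_{\mathcal U}(f)(v)=d^\omega_v f(v)$. Then $\mathcal L_{\mathcal U}=S_{\mathcal U}^{-1/2}\Delta_{\mathcal U}S_{\mathcal U}^{-1/2}$.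 **The three classes.** - $(\mathscr C1)$ $M$ is a smooth manifold with a smooth Riemannian metric $\mathfrak g$, and $\mu=\mu_{\mathfrak g}$ is the Riemannian measure. - $(\mathscr C2)$ $M$ is a compact smooth surface (possibly with boundary) with a conformal class of smooth Riemannian metrics, $\mathfrak g$ is a metric in the class, and $\mu$ is a Radon measure absolutely continuous with respect to the area measure $\mu_{\mathfrak g}$. (The Dirichlet integral below does not depend on the choice of $\mathfrak g$ in the class.) - $(\mathscr C3)$ $M=\Gamma$ is a metric graph (a finite connected graph in which each edge $e$ is realized as a closed interval of length $\ell_e>0$, glued at the vertices) and $\mu=dx$ is Lebesgue measure. **Eigenvalues.** In cases $(\mathscr C1)$ and $(\mathscr C2)$, $$\lambda_k(M)=\inf_{\Lambda_{k+1}}\ \sup_{f\in\Lambda_{k+1}\setminus\{0\}}\frac{\int_M|\nabla_{\mathfrak g}f|^2\,d\mu_{\mathfrak g}}{\int_M f^2\,d\mu},$$ where $\Lambda_{k+1}\subset L^2(M,\mu)$ ranges over $(k+1)$-dimensional subspaces consisting of smooth functions on $M$. In case $(\mathscr C3)$, $$\lambda_k(\Gamma)=\inf_{\Lambda_{k+1}}\ \sup_{f\in\Lambda_{k+1}\setminus\{0\}}\frac{\int_\Gamma (f')^2\,dx}{\int_\Gamma f^2\,dx},$$ where $\Lambda_{k+1}$ ranges over $(k+1)$-dimensional subspaces of the space $\mathrm{Zh}(\Gamma)$ of functions $f:\Gamma\to\mathbb R$ that are piecewise smooth (for some subdivision of $\Gamma$ into finitely many closed segments, the restriction of $f$ to each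 segment is $C^2$; in particular $f$ is continuous) with $f''\in L^1(\Gamma,dx)$. **Neumann value.** For an open set $U\subset M$, in cases $(\mathscr C1)$ and $(\mathscr C2)$, $$\lambda(U)=\inf_f\frac{\int_U|\nabla_{\mathfrak g}f|^2\,d\mu_{\mathfrak g}}{\int_U f^2\,d\mu},$$ over smooth functions $f\in L^2(U,\mu)$ on $U$, nonzero in $L^2(U,\mu)$, which extend continuously to the closure $\overline U$ and satisfy $\int_U f\,d\mu=0$. In case $(\mathscr C3)$ it is defined in the same way, with $\int_U (f')^2\,dx$ in the numerator and with piecewise $C^2$ continuous functions in place of smooth ones.
   Formalization: In class C2 it is additionally assumed that almost every point for the area measure lies in at most two of the sets U_v; without this the claim fails when μ vanishes on open sets where three or more U_v overlap. *)

theory Defs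
  imports
    "HOL-Analysis.Analysis"
    "HOL-Library.Multiset"
    "Graph_Theory.Digraph_Component"
begin

section \<open>Smooth functions on subsets of Euclidean space\<close>

text \<open>Meaningful for open \<open>W\<close> only.\<close>

primrec Ck_on :: "nat \<Rightarrow> ('b::euclidean_space \<Rightarrow> 'c::real_normed_vector) \<Rightarrow> 'b set \<Rightarrow> bool" where
  "Ck_on 0 = (\<lambda>f W. continuous_on W f)"
| "Ck_on (Suc k) = (\<lambda>f W. f differentiable_on W \<and>
     (\<forall>b\<in>Basis. Ck_on k (\<lambda>x. frechet_derivative f (at x) b) W))"

text \<open>On a set that need not be open (a relatively open piece of a half-space), smooth means that
  \<open>f\<close> extends to a smooth function near every point. For open \<open>S\<close> this is ordinary smoothness.\<close>

definition smooth_on :: "'b::euclidean_space set \<Rightarrow> ('b \<Rightarrow> 'c::real_normed_vector) \<Rightarrow> bool" where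
  "smooth_on S f \<longleftrightarrow> (\<forall>x\<in>S. \<exists>W h. open W \<and> x \<in> W \<and> (\<forall>k. Ck_on k h W) \<and> (\<forall>y\<in>S \<inter> W. h y = f y))"


section \<open>Smooth manifolds, possibly with boundary\<close>

text \<open>A chart is a pair of its domain and its coordinate map.\<close>

type_synonym ('a, 'n) chart = "'a set \<times> ('a \<Rightarrow> real ^ 'n)"

abbreviation dom_of :: "('a, 'n) chart \<Rightarrow> 'a set" where "dom_of c \<equiv> fst c"
abbreviation coord :: "('a, 'n) chart \<Rightarrow> 'a \<Rightarrow> real ^ 'n" where "coord c \<equiv> snd c"
abbreviation range_of :: "('a, 'n) chart \<Rightarrow> (real ^ 'n) set" where "range_of c \<equiv> coord c ` dom_of c"

definition param :: "('a, 'n) chart \<Rightarrow> real ^ 'n \<Rightarrow> 'a" where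
  "param c = inv_into (dom_of c) (coord c)"

text \<open>The model set \<open>H\<close> is the whole space for manifolds without boundary, and a closed half-space
  for manifolds with (possibly empty) boundary.\<close>

definition chart_on :: "(real ^ 'n::finite) set \<Rightarrow> 'a topology \<Rightarrow> ('a, 'n) chart \<Rightarrow> bool" where
  "chart_on H X c \<longleftrightarrow> openin X (dom_of c) \<and> openin (top_of_set H) (range_of c) \<and>
     homeomorphic_map (subtopology X (dom_of c)) (top_of_set (range_of c)) (coord c)"

definition second_countable_space :: "'a topology \<Rightarrow> bool" where
  "second_countable_space X \<longleftrightarrow> (\<exists>\<B>. countable \<B> \<and> (\<forall>B\<in>\<B>. openin X B) \<and>
     (\<forall>W p. openin X W \<and> p \<in> W \<longrightarrow> (\<exists>B\<in>\<B>. p \<in> B \<and> B \<subseteq> W)))"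

definition transition :: "('a, 'n) chart \<Rightarrow> ('a, 'n) chart \<Rightarrow> real ^ 'n \<Rightarrow> real ^ 'n" where
  "transition c d = coord d \<circ> param c"

definition smooth_manifold ::
    "(real ^ 'n::finite) set \<Rightarrow> 'a topology \<Rightarrow> ('a, 'n) chart set \<Rightarrow> bool" where
  "smooth_manifold H X A \<longleftrightarrow> Hausdorff_space X \<and> second_countable_space X \<and>
     (\<forall>c\<in>A. chart_on H X c) \<and> (\<Union>c\<in>A. dom_of c) = topspace X \<and>
     (\<forall>c\<in>A. \<forall>d\<in>A. smooth_on (coord c ` (dom_of c \<inter> dom_of d)) (transition c d))"

definition smooth_functions :: "('a, 'n::finite) chart set \<Rightarrow> 'a set \<Rightarrow> ('a \<Rightarrow> real) set" where
  "smooth_functions A U = {f. \<forall>c\<in>A. smooth_on (coord c ` (dom_of c \<inter> U)) (f \<circ> param c)}"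


section \<open>Riemannian metrics\<close>

text \<open>A metric is given by its coordinate expressions: \<open>g c p\<close> is the inner product at \<open>p\<close> of
  tangent vectors written in the coordinates of the chart \<open>c\<close>. At boundary points the derivatives
  are taken within the image of the chart; they are unique there.\<close>

type_synonym ('a, 'n) metric = "('a, 'n) chart \<Rightarrow> 'a \<Rightarrow> real ^ 'n \<Rightarrow> real ^ 'n \<Rightarrow> real"

definition riemannian_metric :: "('a, 'n::finite) chart set \<Rightarrow> ('a, 'n) metric \<Rightarrow> bool" where
  "riemannian_metric A g \<longleftrightarrow>
     (\<forall>c\<in>A. \<forall>p\<in>dom_of c. bilinear (g c p) \<and> (\<forall>v w. g c p v w = g c p w v) \<and>
        (\<forall>v. v \<noteq> 0 \<longrightarrow> 0 < g c p v v)) \<and>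
     (\<forall>c\<in>A. \<forall>v w. smooth_on (range_of c) (\<lambda>x. g c (param c x) v w)) \<and>
     (\<forall>c\<in>A. \<forall>d\<in>A. \<forall>p\<in>dom_of c \<inter> dom_of d. \<forall>v w.
        let T = frechet_derivative (transition c d)
                  (at (coord c p) within coord c ` (dom_of c \<inter> dom_of d))
        in g c p v w = g d p (T v) (T w))"

definition conformal_class ::
    "('a, 'n::finite) chart set \<Rightarrow> ('a, 'n) metric \<Rightarrow> ('a, 'n) metric set" where
  "conformal_class A g\<^sub>0 = {g. riemannian_metric A g \<and>
     (\<exists>\<rho>. \<rho> \<in> smooth_functions A UNIV \<and>
        (\<forall>c\<in>A. \<forall>p\<in>dom_of c. 0 < \<rho> p \<and> (\<forall>v w. g c p v w = \<rho> p * g\<^sub>0 c p v w)))}"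

definition gradient ::
    "('a, 'n::finite) metric \<Rightarrow> ('a, 'n) chart \<Rightarrow> ('a \<Rightarrow> real) \<Rightarrow> 'a \<Rightarrow> real ^ 'n" where
  "gradient g c f p = (THE w. \<forall>v. g c p w v =
     frechet_derivative (f \<circ> param c) (at (coord c p) within range_of c) v)"

definition grad_norm_sq ::
    "('a, 'n::finite) chart set \<Rightarrow> ('a, 'n) metric \<Rightarrow> ('a \<Rightarrow> real) \<Rightarrow> 'a \<Rightarrow> real" where
  "grad_norm_sq A g f p = (THE s. \<forall>c\<in>A. p \<in> dom_of c \<longrightarrow>
     s = g c p (gradient g c f p) (gradient g c f p))"

definition borel_sets :: "'a topology \<Rightarrow> 'a set set" where
  "borel_sets X = sigma_sets (topspace X) {W. openin X W}"

definition riemannian_measure ::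
    "'a topology \<Rightarrow> ('a, 'n::finite) chart set \<Rightarrow> ('a, 'n) metric \<Rightarrow> 'a measure \<Rightarrow> bool" where
  "riemannian_measure X A g \<mu> \<longleftrightarrow> space \<mu> = topspace X \<and> sets \<mu> = borel_sets X \<and>
     (\<forall>c\<in>A. \<forall>B\<in>sets \<mu>. B \<subseteq> dom_of c \<longrightarrow>
        emeasure \<mu> B = (\<integral>\<^sup>+x\<in>coord c ` B.
          ennreal (sqrt (det (\<chi> i j. g c (param c x) (axis i 1) (axis j 1)))) \<partial>lborel))"

definition radon_measure :: "'a topology \<Rightarrow> 'a measure \<Rightarrow> bool" where
  "radon_measure X \<mu> \<longleftrightarrow> space \<mu> = topspace X \<and> sets \<mu> = borel_sets X \<and>
     (\<forall>p\<in>topspace X. \<exists>W. openin X W \<and> p \<in> W \<and> emeasure \<mu> W < \<infinity>) \<and>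
     (\<forall>B\<in>sets \<mu>. emeasure \<mu> B = (SUP K\<in>{K. compactin X K \<and> K \<in> sets \<mu> \<and> K \<subseteq> B}. emeasure \<mu> K))"


section \<open>Metric graphs\<close>

text \<open>\<open>X\<close> is the quotient of the disjoint union of the vertices and of the intervals
  \<open>{0..\<l> e}\<close>, glued at the endpoints; \<open>\<phi> e\<close> parametrizes the edge \<open>e\<close>. Loops and
  multiple edges are allowed. The orientation of the arcs of \<open>G\<close> only serves to
  parametrize the edges; \<open>Digraph_Component.connected\<close> ignores it.\<close>

definition metric_graph ::
    "'a topology \<Rightarrow> ('a, 'e) pre_digraph \<Rightarrow> ('e \<Rightarrow> real) \<Rightarrow> ('e \<Rightarrow> real \<Rightarrow> 'a) \<Rightarrow> bool" where
  "metric_graph X G \<l> \<phi> \<longleftrightarrow> fin_digraph G \<and> Digraph_Component.connected G \<and>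
     (\<forall>e\<in>arcs G. 0 < \<l> e \<and> \<phi> e 0 = tail G e \<and> \<phi> e (\<l> e) = head G e) \<and>
     inj_on (\<lambda>(e, t). \<phi> e t) (SIGMA e:arcs G. {0<..<\<l> e}) \<and>
     (\<forall>e\<in>arcs G. \<phi> e ` {0<..<\<l> e} \<inter> verts G = {}) \<and>
     topspace X = verts G \<union> (\<Union>e\<in>arcs G. \<phi> e ` {0..\<l> e}) \<and>
     (\<forall>W. W \<subseteq> topspace X \<longrightarrow> openin X W =
        (\<forall>e\<in>arcs G. openin (top_of_set {0..\<l> e}) {t\<in>{0..\<l> e}. \<phi> e t \<in> W}))"

definition graph_lebesgue_measure ::
    "'a topology \<Rightarrow> ('a, 'e) pre_digraph \<Rightarrow> ('e \<Rightarrow> real) \<Rightarrow> ('e \<Rightarrow> real \<Rightarrow> 'a) \<Rightarrow> 'a measure \<Rightarrow> bool" where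
  "graph_lebesgue_measure X G \<l> \<phi> \<mu> \<longleftrightarrow> space \<mu> = topspace X \<and> sets \<mu> = borel_sets X \<and>
     (\<forall>B\<in>sets \<mu>. emeasure \<mu> B = (\<Sum>e\<in>arcs G. emeasure lborel {t\<in>{0..\<l> e}. \<phi> e t \<in> B}))"

text \<open>Derivatives are taken within \<open>S\<close>, hence one-sided at the ends of a segment.\<close>

definition C2_on :: "real set \<Rightarrow> (real \<Rightarrow> real) \<Rightarrow> bool" where
  "C2_on S h \<longleftrightarrow> (\<exists>h' h''. (\<forall>t\<in>S. (h has_real_derivative h' t) (at t within S) \<and>
     (h' has_real_derivative h'' t) (at t within S)) \<and> continuous_on S h'')"

text \<open>\<open>P\<close> is the set of subdivision points of the edge \<open>e\<close>.\<close>

definition piecewise_C2_on ::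
    "('a, 'e) pre_digraph \<Rightarrow> ('e \<Rightarrow> real) \<Rightarrow> ('e \<Rightarrow> real \<Rightarrow> 'a) \<Rightarrow> 'a set \<Rightarrow> ('a \<Rightarrow> real) \<Rightarrow> bool" where
  "piecewise_C2_on G \<l> \<phi> U f \<longleftrightarrow> (\<forall>e\<in>arcs G. \<exists>P. finite P \<and> {0, \<l> e} \<subseteq> P \<and> P \<subseteq> {0..\<l> e} \<and>
     (\<forall>a\<in>P. \<forall>b\<in>P. a < b \<and> {a<..<b} \<inter> P = {} \<longrightarrow> C2_on {t\<in>{a..b}. \<phi> e t \<in> U} (f \<circ> \<phi> e)))"

definition Zh :: "'a topology \<Rightarrow> ('a, 'e) pre_digraph \<Rightarrow> ('e \<Rightarrow> real) \<Rightarrow> ('e \<Rightarrow> real \<Rightarrow> 'a) \<Rightarrow> ('a \<Rightarrow> real) set" where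
  "Zh X G \<l> \<phi> = {f. continuous_map X euclideanreal f \<and> piecewise_C2_on G \<l> \<phi> (topspace X) f \<and>
     (\<forall>e\<in>arcs G. set_integrable lborel {0..\<l> e} (deriv (deriv (f \<circ> \<phi> e))))}"


section \<open>Measured spaces with a Dirichlet integral; eigenvalues and Neumann values\<close>

text \<open>\<open>global_functions\<close> are the functions on the whole space that enter the eigenvalues,
  \<open>local_functions U\<close> those on an open set \<open>U\<close> that enter the Neumann value of \<open>U\<close> (before the
  \<open>L\<^sup>2\<close>, mean-value and extension conditions), and \<open>energy U f\<close> is the Dirichlet integral
  of \<open>f\<close> over \<open>U\<close>. Functions are total, but only their values on the set in question matter.\<close>

record 'a dirichlet_space =
  points :: "'a topology"
  mass :: "'a measure"
  global_functions :: "('a \<Rightarrow> real) set"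
  local_functions :: "'a set \<Rightarrow> ('a \<Rightarrow> real) set"
  energy :: "'a set \<Rightarrow> ('a \<Rightarrow> real) \<Rightarrow> ennreal"

definition L2 :: "'a measure \<Rightarrow> ('a \<Rightarrow> real) set" where
  "L2 \<mu> = {f. f \<in> borel_measurable \<mu> \<and> integrable \<mu> (\<lambda>x. (f x)\<^sup>2)}"

text \<open>The \<open>d\<close>-dimensional subspaces of \<open>L2 \<mu>\<close>: the span of \<open>d\<close> functions
  that are linearly independent modulo equality almost everywhere.\<close>

definition L2_subspace :: "'a measure \<Rightarrow> nat \<Rightarrow> ('a \<Rightarrow> real) set \<Rightarrow> bool" where
  "L2_subspace \<mu> d L \<longleftrightarrow> L \<subseteq> L2 \<mu> \<and>
     (\<exists>b. L = {(\<lambda>x. \<Sum>i<d. a i * b i x) | a. True} \<and>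
       (\<forall>a. (AE x in \<mu>. (\<Sum>i<d. a i * b i x) = 0) \<longrightarrow> (\<forall>i<d. a i = 0)))"

definition rayleigh :: "'a dirichlet_space \<Rightarrow> 'a set \<Rightarrow> ('a \<Rightarrow> real) \<Rightarrow> ennreal" where
  "rayleigh M U f = energy M U f / (\<integral>\<^sup>+x\<in>U. ennreal ((f x)\<^sup>2) \<partial>mass M)"

definition eigenvalue :: "'a dirichlet_space \<Rightarrow> nat \<Rightarrow> ennreal" where
  "eigenvalue M k =
     (INF L\<in>{L. L2_subspace (mass M) (k + 1) L \<and> L \<subseteq> global_functions M}.
        SUP f\<in>{f\<in>L. \<not> (AE x in mass M. f x = 0)}. rayleigh M (topspace (points M)) f)"

definition neumann_value :: "'a dirichlet_space \<Rightarrow> 'a set \<Rightarrow> ennreal" where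
  "neumann_value M U =
     (INF f\<in>{f\<in>local_functions M U. f \<in> L2 (restrict_space (mass M) U) \<and>
          \<not> (AE x in restrict_space (mass M) U. f x = 0) \<and>
          (\<exists>h. continuous_map (subtopology (points M) (points M closure_of U)) euclideanreal h \<and>
             (\<forall>x\<in>U. h x = f x)) \<and>
          has_bochner_integral (restrict_space (mass M) U) f 0}.
        rayleigh M U f)"


section \<open>The three classes\<close>

definition class_C1 ::
    "'a dirichlet_space \<Rightarrow> ('a, 'n::finite) chart set \<Rightarrow> ('a, 'n) metric \<Rightarrow> bool" where
  "class_C1 M A g \<longleftrightarrow>
     smooth_manifold UNIV (points M) A \<and> riemannian_metric A g \<and>
     riemannian_measure (points M) A g (mass M) \<and>
     global_functions M = smooth_functions A (topspace (points M)) \<and>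
     local_functions M = smooth_functions A \<and>
     energy M = (\<lambda>U f. \<integral>\<^sup>+x\<in>U. ennreal (grad_norm_sq A g f x) \<partial>mass M)"

text \<open>Here \<open>\<C>\<close> is the conformal class and \<open>area\<close> the area measure of \<open>g\<close>. The energy is
  integrated against \<open>area\<close>, while the mass may vanish on sets of positive area; a cover that is
  two-fold almost everywhere for the mass may then have large multiplicity on such a set. The
  comparison of eigenvalues fails for such covers, so in this class it is stated together with the
  condition that almost every point for \<open>area\<close> lies in at most two members of the cover. The
  condition is automatic if \<open>area\<close> is absolutely continuous with respect to the mass.\<close>

definition class_C2 ::
    "'a dirichlet_space \<Rightarrow> ('a, 2) chart set \<Rightarrow> ('a, 2) metric set \<Rightarrow> ('a, 2) metric \<Rightarrow> 'a measure \<Rightarrow> bool" where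
  "class_C2 M A \<C> g area \<longleftrightarrow>
     smooth_manifold {x. 0 \<le> x $ 2} (points M) A \<and> compact_space (points M) \<and>
     (\<exists>g\<^sub>0. riemannian_metric A g\<^sub>0 \<and> \<C> = conformal_class A g\<^sub>0) \<and> g \<in> \<C> \<and>
     riemannian_measure (points M) A g area \<and>
     radon_measure (points M) (mass M) \<and> absolutely_continuous area (mass M) \<and>
     global_functions M = smooth_functions A (topspace (points M)) \<and>
     local_functions M = smooth_functions A \<and>
     energy M = (\<lambda>U f. \<integral>\<^sup>+x\<in>U. ennreal (grad_norm_sq A g f x) \<partial>area)"

definition class_C3 ::
    "'a dirichlet_space \<Rightarrow> ('a, 'e) pre_digraph \<Rightarrow> ('e \<Rightarrow> real) \<Rightarrow> ('e \<Rightarrow> real \<Rightarrow> 'a) \<Rightarrow> bool" where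
  "class_C3 M G \<l> \<phi> \<longleftrightarrow>
     metric_graph (points M) G \<l> \<phi> \<and> graph_lebesgue_measure (points M) G \<l> \<phi> (mass M) \<and>
     global_functions M = Zh (points M) G \<l> \<phi> \<and>
     local_functions M = (\<lambda>U. {f. continuous_map (subtopology (points M) U) euclideanreal f \<and>
       piecewise_C2_on G \<l> \<phi> U f}) \<and>
     energy M = (\<lambda>U f. \<Sum>e\<in>arcs G. \<integral>\<^sup>+t\<in>{t\<in>{0..\<l> e}. \<phi> e t \<in> U}.
       ennreal ((deriv (f \<circ> \<phi> e) t)\<^sup>2) \<partial>lborel)"


section \<open>Two-fold covers and their discrete Laplacian\<close>

definition two_fold_cover :: "'a topology \<Rightarrow> 'a measure \<Rightarrow> ('v::finite \<Rightarrow> 'a set) \<Rightarrow> bool" where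
  "two_fold_cover X \<mu> U \<longleftrightarrow>
     (\<forall>v. openin X (U v) \<and> emeasure \<mu> (U v) \<noteq> 0 \<and> emeasure \<mu> (U v) < \<infinity>) \<and>
     (AE x in \<mu>. card {v. x \<in> U v} = 2)"

definition edge_weight :: "'a measure \<Rightarrow> ('v \<Rightarrow> 'a set) \<Rightarrow> 'v \<Rightarrow> 'v \<Rightarrow> real" where
  "edge_weight \<mu> U u v = measure \<mu> (U u \<inter> U v)"

definition neighbours :: "'a measure \<Rightarrow> ('v \<Rightarrow> 'a set) \<Rightarrow> 'v \<Rightarrow> 'v set" where
  "neighbours \<mu> U v = {u. u \<noteq> v \<and> emeasure \<mu> (U u \<inter> U v) \<noteq> 0}"

definition weighted_degree :: "'a measure \<Rightarrow> ('v::finite \<Rightarrow> 'a set) \<Rightarrow> 'v \<Rightarrow> real" where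
  "weighted_degree \<mu> U v = (\<Sum>u\<in>neighbours \<mu> U v. edge_weight \<mu> U u v)"

definition graph_laplacian :: "'a measure \<Rightarrow> ('v::finite \<Rightarrow> 'a set) \<Rightarrow> real ^ 'v \<Rightarrow> real ^ 'v" where
  "graph_laplacian \<mu> U f = (\<chi> v. \<Sum>u\<in>neighbours \<mu> U v. (f $ v - f $ u) * edge_weight \<mu> U u v)"

text \<open>The operator \<open>S\<^sup>-\<^sup>1\<^sup>/\<^sup>2\<close>, where \<open>S\<close> is multiplication by the weighted degree.\<close>

definition inv_sqrt_degree :: "'a measure \<Rightarrow> ('v::finite \<Rightarrow> 'a set) \<Rightarrow> real ^ 'v \<Rightarrow> real ^ 'v" where
  "inv_sqrt_degree \<mu> U f = (\<chi> v. f $ v / sqrt (weighted_degree \<mu> U v))"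

definition normalized_laplacian :: "'a measure \<Rightarrow> ('v::finite \<Rightarrow> 'a set) \<Rightarrow> real ^ 'v \<Rightarrow> real ^ 'v" where
  "normalized_laplacian \<mu> U = inv_sqrt_degree \<mu> U \<circ> graph_laplacian \<mu> U \<circ> inv_sqrt_degree \<mu> U"

text \<open>The eigenvalues of a linear operator, listed in nondecreasing order with their geometric
  multiplicities (which for the self-adjoint operator above are also the algebraic ones).\<close>

definition eigenspace :: "(real ^ 'v \<Rightarrow> real ^ 'v) \<Rightarrow> real \<Rightarrow> (real ^ 'v::finite) set" where
  "eigenspace T s = {f. T f = s *\<^sub>R f}"

definition eigenvalue_list :: "(real ^ 'v::finite \<Rightarrow> real ^ 'v) \<Rightarrow> real list" where
  "eigenvalue_list T = sorted_list_of_multiset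
     (\<Sum>s\<in>{s. eigenspace T s \<noteq> {0}}. replicate_mset (dim (eigenspace T s)) s)"

end

theory Submission
  imports Defs
begin

text \<open>Let \<open>T f v = (\<integral>\<^bsub>U\<^sub>v\<^esub> f d\<mu>) / \<surd>\<mu>(U\<^sub>v)\<close>. Since the cover is two-fold, the weighted degree of
  \<open>v\<close> is \<open>\<mu>(U\<^sub>v)\<close>, and therefore \<open>T T\<^sup>* = 2 - \<L>\<close> for the normalized Laplacian \<open>\<L>\<close>. The Neumann bound on
  \<open>U\<^sub>v\<close>, applied to \<open>f\<close> minus its mean and summed over \<open>v\<close>, gives
  \<open>\<eta> (2 \<parallel>f\<parallel>\<^sup>2 - \<parallel>T f\<parallel>\<^sup>2) \<le> 2 \<integral> \<bar>\<nabla>f\<bar>\<^sup>2\<close>.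
  Let \<open>t = \<lambda>\<^sub>k(\<L>)\<close>. A \<open>(k + 1)\<close>-dimensional space of functions contains some \<open>f \<noteq> 0\<close> such that \<open>T f\<close> is
  orthogonal to the at most \<open>k\<close> dimensions of eigenvectors with eigenvalue below \<open>t\<close>. For \<open>c = T f\<close>
  the Cauchy-Schwarz inequality yields
  \<open>\<parallel>c\<parallel>\<^sup>4 = \<langle>f, T\<^sup>* c\<rangle>\<^sup>2 \<le> \<parallel>f\<parallel>\<^sup>2 \<langle>(2 - \<L>) c, c\<rangle> \<le> (2 - t) \<parallel>f\<parallel>\<^sup>2 \<parallel>c\<parallel>\<^sup>2\<close>, so
  \<open>\<parallel>T f\<parallel>\<^sup>2 \<le> (2 - t) \<parallel>f\<parallel>\<^sup>2\<close>, and \<open>f\<close> has Rayleigh quotient at least \<open>\<eta> t / 2\<close>.\<close>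

section \<open>Eigenvalues of self-adjoint operators\<close>

text \<open>The quadratic form attains its minimum on the compact unit sphere of \<open>V\<close>.
  Varying the minimiser \<open>x\<close> within \<open>V\<close> shows that it is an eigenvector;
  invariance of \<open>V\<close> keeps the direction of variation in \<open>V\<close>.\<close>

lemma selfadjoint_min_eigenvector:
  fixes T :: "'b::euclidean_space \<Rightarrow> 'b"
  assumes lin: "linear T" and sym: "\<And>x y. T x \<bullet> y = x \<bullet> T y"
    and V: "subspace V" and inv: "\<And>x. x \<in> V \<Longrightarrow> T x \<in> V" and ne: "V \<noteq> {0}"
  shows "\<exists>x s. x \<in> V \<and> x \<noteq> 0 \<and> T x = s *\<^sub>R x \<and> (\<forall>y\<in>V. s * (y \<bullet> y) \<le> T y \<bullet> y)"
proof -
  let ?S = "V \<inter> sphere 0 1"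
  have unit: "(1 / norm z) *\<^sub>R z \<in> ?S" if "z \<in> V" "z \<noteq> 0" for z
    using that V by (auto simp: subspace_scale)
  obtain z where z: "z \<in> V" "z \<noteq> 0" using ne V subspace_0 by blast
  have "compact ?S" using V by (simp add: closed_Int_compact closed_subspace)
  moreover have "?S \<noteq> {}" using unit[OF z] by blast
  moreover have "continuous_on ?S (\<lambda>x. T x \<bullet> x)"
    using lin by (intro continuous_intros linear_continuous_on) (simp add: linear_linear)
  ultimately obtain x where x: "x \<in> ?S" and min: "\<forall>y\<in>?S. T x \<bullet> x \<le> T y \<bullet> y"
    using continuous_attains_inf[of ?S "\<lambda>x. T x \<bullet> x"] by blast
  define s where "s = T x \<bullet> x"
  have ge: "s * (y \<bullet> y) \<le> T y \<bullet> y" if y: "y \<in> V" for y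
  proof (cases "y = 0")
    case False
    have "s \<le> T ((1 / norm y) *\<^sub>R y) \<bullet> ((1 / norm y) *\<^sub>R y)"
      unfolding s_def by (rule bspec[OF min unit[OF y False]])
    also have "\<dots> = (T y \<bullet> y) / (y \<bullet> y)"
      by (simp add: linear_scale[OF lin] dot_square_norm power2_eq_square)
    finally show ?thesis using False by (simp add: field_simps)
  qed (simp add: linear_0[OF lin])
  have xV: "x \<in> V" and xx: "x \<bullet> x = 1" using x by (auto simp: dot_square_norm)
  \<comment> \<open>The residual is the direction of variation: along \<open>x + r w\<close> the
    first-order term of the form minus \<open>s\<close> times the squared norm is
    \<open>2 r (w \<bullet> w)\<close>.\<close>
  define w where "w = T x - s *\<^sub>R x"
  have wV: "w \<in> V" unfolding w_def using V inv xV by (simp add: subspace_diff subspace_scale)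
  have quad: "0 \<le> 2 * r * (w \<bullet> w) + r\<^sup>2 * (T w \<bullet> w - s * (w \<bullet> w))" for r
  proof -
    have "x + r *\<^sub>R w \<in> V" using V xV wV by (simp add: subspace_add subspace_scale)
    from ge[OF this] have "s * (1 + 2 * r * (x \<bullet> w) + r\<^sup>2 * (w \<bullet> w)) \<le>
        s + 2 * r * (T x \<bullet> w) + r\<^sup>2 * (T w \<bullet> w)"
      using xx s_def sym[of w x]
      by (simp add: linear_add[OF lin] linear_scale[OF lin] inner_simps inner_commute
          power2_eq_square algebra_simps)
    then have "0 \<le> 2 * r * (T x \<bullet> w - s * (x \<bullet> w)) + r\<^sup>2 * (T w \<bullet> w - s * (w \<bullet> w))"
      by (simp add: algebra_simps)
    moreover have "T x \<bullet> w - s * (x \<bullet> w) = w \<bullet> w"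
      by (simp add: w_def inner_simps inner_commute algebra_simps)
    ultimately show ?thesis by simp
  qed
  have "w = 0"
  proof (rule ccontr)
    assume "w \<noteq> 0"
    define a b where "a = w \<bullet> w" and "b = T w \<bullet> w - s * (w \<bullet> w)"
    have a: "a > 0" using \<open>w \<noteq> 0\<close> by (simp add: a_def)
    have b: "b \<ge> 0" using ge[OF wV] by (simp add: b_def)
    \<comment> \<open>With step \<open>- e\<close> the linear gain
      \<open>2 e a = 2 e^2 (b + 1)\<close> outweighs the quadratic term \<open>e^2 b\<close>,
      leaving the negative value \<open>- e^2 (b + 2)\<close>.\<close>
    define e where "e = a / (b + 1)"
    have e: "e > 0" "a = e * (b + 1)" using a b by (simp_all add: e_def)
    have "0 \<le> 2 * (- e) * a + (- e)\<^sup>2 * b"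
      using quad[of "- e"] by (simp add: a_def b_def)
    also have "\<dots> = - (e\<^sup>2 * (b + 2))"
      unfolding e(2) by (simp add: algebra_simps power2_eq_square)
    finally have "e\<^sup>2 * (b + 2) \<le> 0" by linarith
    moreover have "0 < e\<^sup>2 * (b + 2)" using e(1) b by simp
    ultimately show False by linarith
  qed
  then have "T x = s *\<^sub>R x" by (simp add: w_def)
  moreover have "x \<noteq> 0" using xx by auto
  ultimately show ?thesis using xV ge by blast
qed

section \<open>Eigenspaces and their orthogonal complements\<close>

lemma subspace_eigenspace: "linear T \<Longrightarrow> subspace (eigenspace T s)"
  by (auto simp: eigenspace_def subspace_def linear_0 linear_add linear_scale algebra_simps)

lemma eigenspace_orthogonal:
  assumes "\<And>x y. T x \<bullet> y = x \<bullet> T y" "s \<noteq> r" "x \<in> eigenspace T s" "y \<in> eigenspace T r"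
  shows "x \<bullet> y = 0"
proof -
  have "s * (x \<bullet> y) = r * (x \<bullet> y)"
    using assms(1)[of x y] assms(3,4) by (simp add: eigenspace_def)
  then show ?thesis using assms(2) by simp
qed

text \<open>One nonzero eigenvector chosen per eigenvalue gives an orthogonal, hence independent,
  hence finite family.\<close>

lemma finite_spectrum:
  fixes T :: "real ^ 'v \<Rightarrow> real ^ 'v::finite"
  assumes lin: "linear T" and sym: "\<And>x y. T x \<bullet> y = x \<bullet> T y"
  shows "finite {s. eigenspace T s \<noteq> {0}}"
proof -
  let ?S = "{s. eigenspace T s \<noteq> {0}}"
  have "\<exists>x. x \<in> eigenspace T s \<and> x \<noteq> 0" if "s \<in> ?S" for s
    using that subspace_0[OF subspace_eigenspace[OF lin]] by blast
  then obtain e where e: "\<And>s. s \<in> ?S \<Longrightarrow> e s \<in> eigenspace T s \<and> e s \<noteq> 0" by metis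
  have orth: "e s \<bullet> e r = 0" if "s \<in> ?S" "r \<in> ?S" "s \<noteq> r" for s r
    using eigenspace_orthogonal[OF sym] e that by blast
  \<comment> \<open>If two eigenvalues shared their chosen vector, it would be orthogonal to
    itself.\<close>
  have inj: "inj_on e ?S"
    by (rule inj_onI, rule ccontr) (metis e orth inner_eq_zero_iff)
  have "independent (e ` ?S)"
  proof (rule pairwise_orthogonal_independent)
    show "pairwise orthogonal (e ` ?S)"
      using orth by (auto simp: pairwise_def orthogonal_def)
    show "0 \<notin> e ` ?S" using e by (metis (no_types, lifting) imageE)
  qed
  then have "finite (e ` ?S)" by (rule independent_imp_finite)
  then show ?thesis using inj finite_imageD by blast
qed

text \<open>The vectors orthogonal to all eigenspaces with value in \<open>R\<close> form an
  invariant subspace. The minimum of the form there is an eigenvalue outside \<open>R\<close>, hence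
  at least \<open>t\<close>. Two choices of \<open>R\<close> matter later: all reals, to show that
  eigenvectors span, and the reals below the k-th eigenvalue.\<close>

lemma eigenspace_complement:
  fixes T :: "real ^ 'v \<Rightarrow> real ^ 'v::finite"
  assumes lin: "linear T" and sym: "\<And>x y. T x \<bullet> y = x \<bullet> T y"
    and y: "\<And>s x. s \<in> R \<Longrightarrow> x \<in> eigenspace T s \<Longrightarrow> x \<bullet> y = 0"
    and R: "\<And>s. s \<notin> R \<Longrightarrow> eigenspace T s \<noteq> {0} \<Longrightarrow> t \<le> s"
  shows "t * (y \<bullet> y) \<le> T y \<bullet> y"
proof -
  let ?V = "{y. \<forall>s\<in>R. \<forall>x\<in>eigenspace T s. x \<bullet> y = 0}"
  have V: "subspace ?V" by (auto simp: subspace_def inner_simps)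
  have inv: "T x \<in> ?V" if "x \<in> ?V" for x
    using that by (auto simp: sym[symmetric] eigenspace_def)
  show ?thesis
  proof (cases "?V = {0}")
    case True
    then have "y = 0" using y by blast
    then show ?thesis by (simp add: linear_0[OF lin])
  next
    case False
    have "\<exists>x s. x \<in> ?V \<and> x \<noteq> 0 \<and> T x = s *\<^sub>R x \<and> (\<forall>y\<in>?V. s * (y \<bullet> y) \<le> T y \<bullet> y)"
      by (rule selfadjoint_min_eigenvector[OF lin sym V inv False])
    then obtain x s where x: "x \<in> ?V" "x \<noteq> 0" "T x = s *\<^sub>R x"
      and s: "\<forall>y\<in>?V. s * (y \<bullet> y) \<le> T y \<bullet> y"
      by (elim exE conjE)
    have xe: "x \<in> eigenspace T s" using x by (simp add: eigenspace_def)
    \<comment> \<open>Otherwise \<open>x\<close> would be orthogonal to itself.\<close>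
    then have "s \<notin> R" using x by force
    then have "t \<le> s" using R xe x(2) by blast
    then have "t * (y \<bullet> y) \<le> s * (y \<bullet> y)" by (simp add: mult_right_mono)
    also have "\<dots> \<le> T y \<bullet> y" using y by (intro bspec[OF s]) auto
    finally show ?thesis .
  qed
qed

section \<open>Counting eigenvalues with multiplicity\<close>

lemma dim_UNION_le:
  fixes E :: "'i \<Rightarrow> 'b::euclidean_space set"
  assumes "finite I"
  shows "dim (\<Union>i\<in>I. E i) \<le> (\<Sum>i\<in>I. dim (E i))"
proof -
  have "\<exists>B\<subseteq>E i. independent B \<and> E i \<subseteq> span B \<and> card B = dim (E i)" for i
    by (rule basis_exists[of "E i"]) blast
  then obtain B where B: "\<And>i. B i \<subseteq> E i \<and> independent (B i) \<and> E i \<subseteq> span (B i) \<and> card (B i) = dim (E i)"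
    by metis
  have "(\<Union>i\<in>I. E i) \<subseteq> span (\<Union>i\<in>I. B i)"
  proof (rule UN_least)
    fix i assume "i \<in> I"
    then have "span (B i) \<subseteq> span (\<Union>i\<in>I. B i)" by (intro span_mono) blast
    then show "E i \<subseteq> span (\<Union>i\<in>I. B i)" using B[of i] by blast
  qed
  moreover have "finite (B i)" for i using B[of i] by (auto intro: independent_imp_finite)
  then have "finite (\<Union>i\<in>I. B i)" using assms by simp
  ultimately have "dim (\<Union>i\<in>I. E i) \<le> card (\<Union>i\<in>I. B i)" by (rule dim_le_card)
  also have "\<dots> \<le> (\<Sum>i\<in>I. card (B i))" by (rule card_UN_le[OF assms])
  finally show ?thesis using B by simp
qed

text \<open>With the trivial \<open>P\<close> this is the length of the eigenvalue list; with
  \<open>P s\<close> being \<open>s < t\<close> it counts the entries below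
  \<open>t\<close>.\<close>

lemma size_filter_replicate_sum:
  assumes "finite S"
  shows "size (filter_mset P (\<Sum>s\<in>S. replicate_mset (m s) s)) = (\<Sum>s\<in>{s\<in>S. P s}. m s)"
proof -
  have "filter_mset P (replicate_mset n s) = (if P s then replicate_mset n s else {#})" for n s
    by (induction n) auto
  note filter_rep = this
  have "size (filter_mset P (\<Sum>s\<in>S. replicate_mset (m s) s)) = (\<Sum>s\<in>S. if P s then m s else 0)"
    using assms by (induction rule: finite_induct) (auto simp: filter_rep)
  then show ?thesis using assms by (simp add: sum.If_cases Int_def)
qed

text \<open>Guarantees that an index \<open>k < CARD('v)\<close> picks a genuine entry of the list.
  The eigenspaces span, since a nonzero vector orthogonal to all of them contradicts
  \<open>eigenspace_complement\<close>.\<close>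

lemma eigenvalue_list_length:
  fixes T :: "real ^ 'v \<Rightarrow> real ^ 'v::finite"
  assumes lin: "linear T" and sym: "\<And>x y. T x \<bullet> y = x \<bullet> T y"
  shows "CARD('v) \<le> length (eigenvalue_list T)"
proof -
  let ?S = "{s. eigenspace T s \<noteq> {0}}"
  let ?W = "\<Union>s\<in>?S. eigenspace T s"
  have fin: "finite ?S" by (rule finite_spectrum[OF lin sym])
  have "CARD('v) \<le> dim ?W"
  proof (rule ccontr)
    assume "\<not> CARD('v) \<le> dim ?W"
    then have "dim ?W < DIM(real ^ 'v)" by simp
    then obtain y where y: "y \<noteq> 0" "\<And>x. x \<in> span ?W \<Longrightarrow> orthogonal y x"
      by (rule orthogonal_to_subspace_exists) blast
    have orth: "x \<bullet> y = 0" if "x \<in> eigenspace T s" for s x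
    proof (cases "x = 0")
      case False
      then have "x \<in> span ?W" using that by (intro span_base) blast
      then show ?thesis using y(2) by (simp add: orthogonal_def inner_commute)
    qed simp
    \<comment> \<open>With \<open>R = UNIV\<close> the bound \<open>t\<close> is arbitrary, so it is
      taken to be one more than the Rayleigh quotient of \<open>y\<close>.\<close>
    have "((T y \<bullet> y) / (y \<bullet> y) + 1) * (y \<bullet> y) \<le> T y \<bullet> y"
      by (rule eigenspace_complement[OF lin sym, where R = UNIV]) (auto simp: orth)
    then have "y \<bullet> y \<le> 0" using y(1) by (simp add: distrib_right)
    then show False using y(1) by (metis inner_gt_zero_iff not_le)
  qed
  also have "\<dots> \<le> (\<Sum>s\<in>?S. dim (eigenspace T s))" by (rule dim_UNION_le[OF fin])
  also have "\<dots> = size (\<Sum>s\<in>?S. replicate_mset (dim (eigenspace T s)) s)"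
    using size_filter_replicate_sum[OF fin, of "\<lambda>_. True" "\<lambda>s. dim (eigenspace T s)"] by simp
  also have "\<dots> = length (eigenvalue_list T)"
    unfolding eigenvalue_list_def by (simp add: size_mset[symmetric] del: size_mset)
  finally show ?thesis .
qed

text \<open>In a sorted list only positions before \<open>k\<close> can hold values strictly below
  entry \<open>k\<close>, and each eigenvalue fills as many positions as its eigenspace has
  dimensions.\<close>

lemma eigenvalue_list_nth:
  fixes T :: "real ^ 'v \<Rightarrow> real ^ 'v::finite"
  assumes lin: "linear T" and sym: "\<And>x y. T x \<bullet> y = x \<bullet> T y" and k: "k < CARD('v)"
  shows "eigenspace T (eigenvalue_list T ! k) \<noteq> {0}"
    and "dim (\<Union>s\<in>{s. s < eigenvalue_list T ! k}. eigenspace T s) \<le> k"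
proof -
  let ?S = "{s. eigenspace T s \<noteq> {0}}"
  let ?M = "\<Sum>s\<in>?S. replicate_mset (dim (eigenspace T s)) s"
  let ?l = "eigenvalue_list T" let ?t = "?l ! k"
  have fin: "finite ?S" by (rule finite_spectrum[OF lin sym])
  have len: "k < length ?l" using eigenvalue_list_length[OF lin sym] k by simp
  have l: "mset ?l = ?M" "sorted ?l" by (simp_all add: eigenvalue_list_def)
  have "?t \<in># ?M" using len by (metis l(1) nth_mem_mset)
  then show "eigenspace T ?t \<noteq> {0}" using fin
    by (auto simp: set_mset_sum in_replicate_mset)
  let ?L = "{s\<in>?S. s < ?t}"
  \<comment> \<open>Values that are not eigenvalues contribute only the zero vector; dropping them
    makes the index set finite.\<close>
  have "dim (\<Union>s\<in>{s. s < ?t}. eigenspace T s) \<le> dim (\<Union>s\<in>?L. eigenspace T s)"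
  proof -
    have "(\<Union>s\<in>{s. s < ?t}. eigenspace T s) \<subseteq> span (\<Union>s\<in>?L. eigenspace T s)"
    proof
      fix x assume "x \<in> (\<Union>s\<in>{s. s < ?t}. eigenspace T s)"
      then obtain s where "s < ?t" "x \<in> eigenspace T s" by blast
      then show "x \<in> span (\<Union>s\<in>?L. eigenspace T s)"
        by (cases "x = 0") (auto intro!: span_base span_zero)
    qed
    from dim_subset[OF this] show ?thesis by (simp only: dim_span)
  qed
  also have "\<dots> \<le> (\<Sum>s\<in>?L. dim (eigenspace T s))" using fin by (intro dim_UNION_le) auto
  also have "\<dots> = size (filter_mset (\<lambda>s. s < ?t) ?M)"
    by (rule size_filter_replicate_sum[OF fin, symmetric])
  also have "\<dots> = length (filter (\<lambda>s. s < ?t) ?l)" by (metis l(1) mset_filter size_mset)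
  also have "\<dots> = card {i. i < length ?l \<and> ?l ! i < ?t}" by (rule length_filter_conv_card)
  also have "\<dots> \<le> card {..<k}"
    using l(2) by (intro card_mono) (auto, meson leD linorder_not_less sorted_nth_mono)
  finally show "dim (\<Union>s\<in>{s. s < ?t}. eigenspace T s) \<le> k" by simp
qed

text \<open>The orthogonal projections of the \<open>m\<close> vectors \<open>w i\<close> to
  \<open>span G\<close> lie in a space of dimension below \<open>m\<close>, so some nontrivial
  combination of them vanishes. The same combination of the \<open>w i\<close> is then orthogonal to
  \<open>G\<close>.\<close>

lemma orthogonal_combination_exists:
  fixes w :: "nat \<Rightarrow> 'b::euclidean_space"
  assumes "dim G < m"
  obtains a where "\<exists>i<m. a i \<noteq> 0" "\<And>x. x \<in> G \<Longrightarrow> x \<bullet> (\<Sum>i<m. a i *\<^sub>R w i) = 0"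
proof -
  have "\<exists>p\<in>span G. \<forall>x\<in>span G. orthogonal (w i - p) x" for i
  proof -
    obtain p q where "p \<in> span G" "\<And>x. x \<in> span G \<Longrightarrow> orthogonal q x" "w i = p + q"
      by (rule orthogonal_subspace_decomp_exists[of G "w i"]) blast
    then show ?thesis by (intro bexI[of _ p]) auto
  qed
  then obtain p where p: "\<And>i. p i \<in> span G"
    and q: "\<And>i x. x \<in> span G \<Longrightarrow> orthogonal (w i - p i) x"
    by metis
  have "\<exists>a. (\<exists>i<m. a i \<noteq> 0) \<and> (\<Sum>i<m. a i *\<^sub>R p i) = 0"
  \<comment> \<open>Independence is a property of sets and does not see repeated vectors; two equal
    projections are combined with coefficients 1 and -1 instead.\<close>
  proof (cases "inj_on p {..<m}")
    case True
    have "\<not> independent (p ` {..<m})"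
    proof
      assume "independent (p ` {..<m})"
      then have "card (p ` {..<m}) \<le> dim (span G)" using p
        by (intro independent_card_le_dim) auto
      then show False using True assms by (simp add: card_image)
    qed
    then obtain u v where u: "v \<in> p ` {..<m}" "u v \<noteq> 0" "(\<Sum>v\<in>p ` {..<m}. u v *\<^sub>R v) = 0"
      by (auto simp: dependent_finite)
    then have "(\<Sum>i<m. (u \<circ> p) i *\<^sub>R p i) = 0" by (simp add: sum.reindex[OF True])
    then show ?thesis using u by (intro exI[of _ "u \<circ> p"]) auto
  next
    case False
    then obtain i j where ij: "i < m" "j < m" "i \<noteq> j" "p i = p j" by (auto simp: inj_on_def)
    let ?a = "\<lambda>l. if l = i then 1 else if l = j then - 1 else 0 :: real"
    have "(\<Sum>l<m. ?a l *\<^sub>R p l) = (\<Sum>l\<in>{i, j}. ?a l *\<^sub>R p l)"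
      using ij by (intro sum.mono_neutral_right) auto
    also have "\<dots> = 0" using ij by simp
    finally show ?thesis using ij(1) by (intro exI[of _ ?a]) auto
  qed
  then obtain a where a: "\<exists>i<m. a i \<noteq> 0" "(\<Sum>i<m. a i *\<^sub>R p i) = 0" by blast
  have "(\<Sum>i<m. a i *\<^sub>R w i) = (\<Sum>i<m. a i *\<^sub>R (w i - p i))"
    using a(2) by (simp add: scaleR_diff_right sum_subtractf)
  moreover have "x \<bullet> (w i - p i) = 0" if "x \<in> G" for x i
    using q[of x i] span_base[OF that] by (simp add: orthogonal_def inner_commute)
  ultimately have "x \<bullet> (\<Sum>i<m. a i *\<^sub>R w i) = 0" if "x \<in> G" for x
    using that by (simp add: inner_sum_right)
  then show ?thesis using a(1) that by blast
qed


section \<open>Integration\<close>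

text \<open>Measurability is not assumed: for a non-measurable integrand \<open>nn_integral\<close> is a lower
  integral, which is still superadditive. So the measurability of Dirichlet integrands such as
  \<open>grad_norm_sq A g f\<close> need not be discussed.\<close>

lemma nn_integral_superadditive:
  "(\<integral>\<^sup>+x. f x \<partial>M) + (\<integral>\<^sup>+x. g x \<partial>M) \<le> (\<integral>\<^sup>+x. f x + g x \<partial>M)"
proof -
  let ?S = "\<lambda>f. {s. simple_function M s \<and> s \<le> f}"
  have ne: "?S f \<noteq> {}" for f :: "_ \<Rightarrow> ennreal"
    by (auto intro!: exI[of _ "\<lambda>_. 0"] simp: le_fun_def)
  have "(\<integral>\<^sup>+x. f x \<partial>M) + (\<integral>\<^sup>+x. g x \<partial>M) = (SUP t\<in>?S g. SUP s\<in>?S f. integral\<^sup>S M s + integral\<^sup>S M t)"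
    by (simp add: nn_integral_def ennreal_SUP_add_left[OF ne, symmetric] ennreal_SUP_add_right[OF ne])
  also have "\<dots> \<le> (\<integral>\<^sup>+x. f x + g x \<partial>M)"
  proof (intro SUP_least)
    fix s t assume s: "s \<in> ?S f" and t: "t \<in> ?S g"
    then have "integral\<^sup>S M s + integral\<^sup>S M t = (\<integral>\<^sup>+x. s x + t x \<partial>M)"
      by (simp add: nn_integral_eq_simple_integral[symmetric] nn_integral_add borel_measurable_simple_function)
    also have "\<dots> \<le> (\<integral>\<^sup>+x. f x + g x \<partial>M)"
      using s t by (intro nn_integral_mono) (auto simp: le_fun_def intro: add_mono)
    finally show "integral\<^sup>S M s + integral\<^sup>S M t \<le> (\<integral>\<^sup>+x. f x + g x \<partial>M)" .
  qed
  finally show ?thesis .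
qed

lemma nn_integral_sum_superadditive:
  assumes "finite I"
  shows "(\<Sum>i\<in>I. \<integral>\<^sup>+x. f i x \<partial>M) \<le> (\<integral>\<^sup>+x. (\<Sum>i\<in>I. f i x) \<partial>M)"
  using assms
proof induction
  case (insert i I)
  then show ?case
    using nn_integral_superadditive[of M "f i" "\<lambda>x. \<Sum>i\<in>I. f i x"]
    by (simp add: order_trans[OF add_left_mono])
qed simp

text \<open>Halving a simple function below \<open>2 * f\<close> gives one below \<open>f\<close>,
  so the factor leaves the lower integral without measurability of \<open>f\<close>.\<close>

lemma nn_integral_double_le: "(\<integral>\<^sup>+x. 2 * f x \<partial>M) \<le> 2 * (\<integral>\<^sup>+x. f x \<partial>M)"
  unfolding nn_integral_def[of M "\<lambda>x. 2 * f x"]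
proof (intro SUP_least)
  fix s assume s: "s \<in> {s. simple_function M s \<and> s \<le> (\<lambda>x. 2 * f x)}"
  have half: "2 * (s x / 2) = s x" for x
    by (simp add: ennreal_times_divide mult.commute[of 2] ennreal_mult_divide_eq)
  have le: "s x / 2 \<le> f x" for x
  proof -
    have "s x / 2 \<le> (2 * f x) / 2" using s by (intro divide_right_mono_ennreal) (auto simp: le_fun_def)
    then show ?thesis by (simp add: mult.commute[of 2] ennreal_mult_divide_eq)
  qed
  have m: "s \<in> borel_measurable M" using s by (simp add: borel_measurable_simple_function)
  have "integral\<^sup>S M s = (\<integral>\<^sup>+x. 2 * (s x / 2) \<partial>M)"
    using s by (simp add: half nn_integral_eq_simple_integral)
  also have "\<dots> = 2 * (\<integral>\<^sup>+x. s x / 2 \<partial>M)" using m by (intro nn_integral_cmult) simp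
  also have "\<dots> \<le> 2 * (\<integral>\<^sup>+x. f x \<partial>M)" by (intro mult_left_mono nn_integral_mono le) simp
  finally show "integral\<^sup>S M s \<le> 2 * (\<integral>\<^sup>+x. f x \<partial>M)" .
qed

text \<open>By superadditivity the sum is at most the integral of \<open>f\<close> times the
  multiplicity of the family. It bounds the energy in all three classes, with \<open>N\<close> the
  mass, the area or Lebesgue measure along an edge.\<close>

lemma nn_integral_two_fold_le:
  fixes A :: "'v::finite \<Rightarrow> 'a set"
  assumes card: "AE x in N. x \<in> B \<longrightarrow> card {v. x \<in> A v} \<le> 2" and sub: "\<And>v. A v \<subseteq> B"
  shows "(\<Sum>v\<in>UNIV. \<integral>\<^sup>+x\<in>A v. f x \<partial>N) \<le> 2 * (\<integral>\<^sup>+x\<in>B. f x \<partial>N)"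
proof -
  have "(\<Sum>v\<in>UNIV. \<integral>\<^sup>+x\<in>A v. f x \<partial>N) \<le> (\<integral>\<^sup>+x. (\<Sum>v\<in>UNIV. f x * indicator (A v) x) \<partial>N)"
    by (rule nn_integral_sum_superadditive) simp
  also have "\<dots> \<le> (\<integral>\<^sup>+x. 2 * (f x * indicator B x) \<partial>N)"
  proof (rule nn_integral_mono_AE, use card in eventually_elim)
    fix x assume x: "x \<in> B \<longrightarrow> card {v. x \<in> A v} \<le> 2"
    have "(\<Sum>v\<in>UNIV. f x * indicator (A v) x) = f x * of_nat (card {v. x \<in> A v})"
      by (simp add: sum_distrib_left[symmetric] indicator_def sum.If_cases)
    also have "\<dots> \<le> 2 * (f x * indicator B x)"
    proof (cases "x \<in> B")
      case True
      then have "of_nat (card {v. x \<in> A v}) \<le> (of_nat 2 :: ennreal)" using x by (intro of_nat_mono) simp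
      then show ?thesis using True by (simp add: mult.commute[of 2] mult_left_mono)
    next
      case False
      then have "{v. x \<in> A v} = {}" using sub by blast
      then show ?thesis by simp
    qed
    finally show "(\<Sum>v\<in>UNIV. f x * indicator (A v) x) \<le> 2 * (f x * indicator B x)" .
  qed
  also have "\<dots> \<le> 2 * (\<integral>\<^sup>+x\<in>B. f x \<partial>N)" by (rule nn_integral_double_le)
  finally show ?thesis .
qed

section \<open>Products of square-integrable functions\<close>

lemma integrable_mult_of_squares:
  fixes f g :: "'a \<Rightarrow> real"
  assumes "f \<in> L2 N" "g \<in> L2 N"
  shows "integrable N (\<lambda>x. f x * g x)"
proof (rule Bochner_Integration.integrable_bound)
  show "integrable N (\<lambda>x. (f x)\<^sup>2 + (g x)\<^sup>2)" using assms by (simp add: L2_def)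
  show "(\<lambda>x. f x * g x) \<in> borel_measurable N" using assms by (auto simp: L2_def)
  have "\<bar>a * b\<bar> \<le> a\<^sup>2 + b\<^sup>2" for a b :: real
    using sum_squares_bound[of "\<bar>a\<bar>" "\<bar>b\<bar>"] abs_ge_zero[of "a * b"]
    unfolding abs_mult power2_abs by linarith
  then show "AE x in N. norm (f x * g x) \<le> norm ((f x)\<^sup>2 + (g x)\<^sup>2)" by simp
qed

lemma Cauchy_Schwarz_integral:
  assumes f: "f \<in> L2 N" and g: "g \<in> L2 N"
  shows "(\<integral>x. f x * g x \<partial>N)\<^sup>2 \<le> (\<integral>x. (f x)\<^sup>2 \<partial>N) * (\<integral>x. (g x)\<^sup>2 \<partial>N)"
proof -
  define a b c where "a = (\<integral>x. (f x)\<^sup>2 \<partial>N)" and "b = (\<integral>x. f x * g x \<partial>N)" and "c = (\<integral>x. (g x)\<^sup>2 \<partial>N)"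
  have int: "integrable N (\<lambda>x. (f x)\<^sup>2)" "integrable N (\<lambda>x. (g x)\<^sup>2)" "integrable N (\<lambda>x. f x * g x)"
    using f g integrable_mult_of_squares[OF f g] by (auto simp: L2_def)
  show ?thesis
  proof (cases "a = 0")
    case True
    then have "AE x in N. (f x)\<^sup>2 = 0"
      using integral_nonneg_eq_0_iff_AE[OF int(1)] by (simp add: a_def)
    then have "b = (\<integral>x. 0 \<partial>N)" unfolding b_def using f g
      by (intro integral_cong_AE) (auto simp: L2_def)
    then show ?thesis using True by (simp add: a_def b_def)
  next
    case False
    have "a \<ge> 0" by (simp add: a_def)
    with False have a: "a > 0" by simp
    \<comment> \<open>Up to the factor \<open>a\<close>, this is the component of \<open>g\<close>
      orthogonal to \<open>f\<close>; its squared norm expands to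
      \<open>a * (a * c - b^2)\<close>.\<close>
    have "0 \<le> (\<integral>x. (b * f x - a * g x)\<^sup>2 \<partial>N)" by simp
    also have "\<dots> = (\<integral>x. b\<^sup>2 * (f x)\<^sup>2 - 2 * a * b * (f x * g x) + a\<^sup>2 * (g x)\<^sup>2 \<partial>N)"
      by (simp add: power2_eq_square algebra_simps)
    also have "\<dots> = b\<^sup>2 * a - 2 * a * b * b + a\<^sup>2 * c"
      using int by (simp add: a_def b_def c_def)
    also have "\<dots> = a * (a * c - b\<^sup>2)" by (simp add: power2_eq_square algebra_simps)
    finally have "b\<^sup>2 \<le> a * c" using a by (simp add: zero_le_mult_iff)
    then show ?thesis by (simp add: a_def b_def c_def)
  qed
qed


section \<open>Comparison of eigenvalues for an abstract Dirichlet space\<close>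

text \<open>Collects what the comparison takes from the three classes. Continuity and the two shift
  conditions make a global function minus its mean a Neumann test function on each
  \<open>U v\<close>; \<open>energy_two_fold\<close> lets the local energies be summed.\<close>

locale two_fold_dirichlet =
  fixes M :: "'a dirichlet_space" and U :: "'v::finite \<Rightarrow> 'a set"
  assumes sets_open: "openin (points M) W \<Longrightarrow> W \<in> sets (mass M)"
    and space_mass: "space (mass M) = topspace (points M)"
    and cover: "two_fold_cover (points M) (mass M) U"
    and global_continuous: "f \<in> global_functions M \<Longrightarrow> continuous_map (points M) euclideanreal f"
    and local_shift: "f \<in> global_functions M \<Longrightarrow> openin (points M) W \<Longrightarrow>
      (\<lambda>x. f x - a) \<in> local_functions M W"
    and energy_shift: "energy M W (\<lambda>x. f x - a) = energy M W f"
    and energy_two_fold: "(\<Sum>v\<in>UNIV. energy M (U v) f) \<le> 2 * energy M (topspace (points M)) f"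
begin

abbreviation "\<mu> \<equiv> mass M"
abbreviation "L \<equiv> normalized_laplacian \<mu> U"

definition "size_of v = measure \<mu> (U v)"

text \<open>The operator \<open>T\<close> of the introduction; \<open>spread\<close> below is its adjoint.\<close>

definition "averages f = (\<chi> v. (\<integral>x. indicator (U v) x * f x \<partial>\<mu>) / sqrt (size_of v))"

section \<open>Measures and overlaps of the members of the cover\<close>

lemma open_U: "openin (points M) (U v)" and finite_U: "emeasure \<mu> (U v) < \<infinity>"
  and AE_card: "AE x in \<mu>. card {v. x \<in> U v} = 2"
  using cover by (auto simp: two_fold_cover_def)

lemma sets_U [measurable]: "U v \<in> sets \<mu>"
  by (rule sets_open[OF open_U])

lemma size_pos: "0 < size_of v"
  using cover by (auto simp: size_of_def two_fold_cover_def measure_def enn2real_positive_iff less_top zero_less_iff_neq_zero)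

lemma sum_indicator: "AE x in \<mu>. (\<Sum>v\<in>UNIV. indicator (U v) x) = (2::real)"
  using AE_card by eventually_elim (simp add: indicator_def sum.If_cases)

lemma integrable_indicator_U [simp]: "integrable \<mu> (indicator (U v) :: 'a \<Rightarrow> real)"
  using finite_U by (simp add: less_top)

lemma integrable_indicator_mult:
  "integrable \<mu> f \<Longrightarrow> integrable \<mu> (\<lambda>x. indicator (U v) x * f x :: real)"
  by (simp add: integrable_real_mult_indicator mult.commute)

lemma indicator_L2: "indicator (U v) \<in> L2 \<mu>"
proof -
  have "(\<lambda>x. (indicator (U v) x)\<^sup>2) = (indicator (U v) :: 'a \<Rightarrow> real)"
    by (auto simp: indicator_def)
  then show ?thesis by (simp add: L2_def)
qed

lemma sum_integral_U:
  fixes f :: "'a \<Rightarrow> real"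
  assumes "integrable \<mu> f"
  shows "(\<Sum>v\<in>UNIV. \<integral>x. indicator (U v) x * f x \<partial>\<mu>) = 2 * (\<integral>x. f x \<partial>\<mu>)"
proof -
  have "(\<Sum>v\<in>UNIV. \<integral>x. indicator (U v) x * f x \<partial>\<mu>) = (\<integral>x. (\<Sum>v\<in>UNIV. indicator (U v) x) * f x \<partial>\<mu>)"
    unfolding sum_distrib_right
    by (rule Bochner_Integration.integral_sum[symmetric]) (rule integrable_indicator_mult[OF assms])
  also have "\<dots> = (\<integral>x. 2 * f x \<partial>\<mu>)"
  proof (rule integral_cong_AE)
    show "AE x in \<mu>. (\<Sum>v\<in>UNIV. indicator (U v) x) * f x = 2 * f x"
      using sum_indicator by eventually_elim simp
  qed (use assms in measurable)
  finally show ?thesis by simp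
qed

lemma integral_indicator_inter:
  "(\<integral>x. indicator (U u) x * indicator (U v) x \<partial>\<mu>) = measure \<mu> (U u \<inter> U v)"
proof -
  have "(\<integral>x. indicator (U u) x * indicator (U v) x \<partial>\<mu>) = (\<integral>x. indicat_real (U u \<inter> U v) x \<partial>\<mu>)"
    by (simp add: indicator_inter_arith)
  also have "\<dots> = measure \<mu> (U u \<inter> U v)" by (simp add: sets.Int_space_eq2 sets.Int)
  finally show ?thesis .
qed

text \<open>A non-neighbour other than \<open>v\<close> itself has overlap of measure zero with
  \<open>U v\<close>, so the sum over all indices differs only by the diagonal term.\<close>

lemma sum_neighbours:
  "(\<Sum>u\<in>neighbours \<mu> U v. h u * edge_weight \<mu> U u v) =
    (\<Sum>u\<in>UNIV. h u * measure \<mu> (U u \<inter> U v)) - h v * size_of v"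
proof -
  have "(\<Sum>u\<in>neighbours \<mu> U v. h u * edge_weight \<mu> U u v) = (\<Sum>u\<in>UNIV - {v}. h u * measure \<mu> (U u \<inter> U v))"
    by (rule sum.mono_neutral_cong_left) (auto simp: neighbours_def edge_weight_def measure_def)
  then show ?thesis by (simp add: sum_diff1 size_of_def)
qed

lemma sum_overlap: "(\<Sum>u\<in>UNIV. measure \<mu> (U u \<inter> U v)) = 2 * size_of v"
  using sum_integral_U[OF integrable_indicator_U, of v]
  by (simp add: integral_indicator_inter) (simp add: size_of_def sets.Int_space_eq2)

lemma weighted_degree_eq: "weighted_degree \<mu> U v = size_of v"
  using sum_neighbours[of "\<lambda>_. 1" v] by (simp add: weighted_degree_def sum_overlap)

text \<open>The Gram matrix of the normalized indicators of the \<open>U v\<close>, that is, the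
  operator \<open>T T*\<close> of the introduction.\<close>

definition "overlap = (\<lambda>c. \<chi> v. \<Sum>u\<in>UNIV. measure \<mu> (U u \<inter> U v) / (sqrt (size_of u) * sqrt (size_of v)) * c $ u)"

text \<open>The 2 is the full row sum \<open>2 * size_of v\<close> of the overlaps divided by the
  degree \<open>size_of v\<close>. Including the diagonal is harmless because its difference
  \<open>?b v - ?b v\<close> is zero.\<close>

lemma laplacian_eq: "L c = 2 *\<^sub>R c - overlap c"
unfolding vec_eq_iff
proof
  fix v
  let ?r = "sqrt (size_of v)"
  let ?b = "\<lambda>u. c $ u / sqrt (size_of u)"
  have r: "?r > 0" "?r * ?r = size_of v" using size_pos[of v] by auto
  have "L c $ v = (\<Sum>u\<in>neighbours \<mu> U v. (?b v - ?b u) * edge_weight \<mu> U u v) / ?r"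
    by (simp add: normalized_laplacian_def inv_sqrt_degree_def graph_laplacian_def weighted_degree_eq)
  also have "\<dots> = (\<Sum>u\<in>UNIV. (?b v - ?b u) * measure \<mu> (U u \<inter> U v)) / ?r"
    by (simp add: sum_neighbours)
  also have "(\<Sum>u\<in>UNIV. (p - ?b u) * w u) = p * (\<Sum>u\<in>UNIV. w u) - (\<Sum>u\<in>UNIV. ?b u * w u)" for p w
    by (simp only: left_diff_distrib sum_subtractf sum_distrib_left)
  also have "(?b v * (\<Sum>u\<in>UNIV. measure \<mu> (U u \<inter> U v)) - (\<Sum>u\<in>UNIV. ?b u * measure \<mu> (U u \<inter> U v))) / ?r =
      (?b v * (2 * size_of v) - (\<Sum>u\<in>UNIV. ?b u * measure \<mu> (U u \<inter> U v))) / ?r"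
    by (simp only: sum_overlap)
  also have "\<dots> = 2 * c $ v - (\<Sum>u\<in>UNIV. ?b u * measure \<mu> (U u \<inter> U v)) / ?r"
  proof -
    have "x / r * (2 * s) / r = 2 * x" if "r > 0" "r * r = s" for x r s :: real
      using that by (auto simp: field_simps)
    from this[OF r, of "c $ v"] have "?b v * (2 * size_of v) / ?r = 2 * c $ v" .
    then show ?thesis by (simp only: diff_divide_distrib)
  qed
  also have "(\<Sum>u\<in>UNIV. ?b u * measure \<mu> (U u \<inter> U v)) / ?r = overlap c $ v"
    by (simp add: overlap_def sum_divide_distrib mult_ac)
  finally show "L c $ v = (2 *\<^sub>R c - overlap c) $ v" by simp
qed

lemma linear_laplacian: "linear L"
proof -
  have "linear overlap"
    by (rule linearI) (simp_all add: overlap_def vec_eq_iff sum.distrib algebra_simps add_divide_distrib sum_distrib_left)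
  then show ?thesis unfolding laplacian_eq[abs_def] 
    by (intro linear_compose_sub linear_scaleR) auto
qed

lemma laplacian_selfadjoint: "L c \<bullet> d = c \<bullet> L d"
proof -
  have "overlap c \<bullet> d = c \<bullet> overlap d"
    unfolding overlap_def inner_vec_def
    by (simp add: sum_distrib_left sum_distrib_right, subst sum.swap) (simp add: mult_ac Int_commute)
  then show ?thesis by (simp add: laplacian_eq inner_simps)
qed

definition "spread c x = (\<Sum>v\<in>UNIV. c $ v / sqrt (size_of v) * indicator (U v) x)"

text \<open>Expanding the square of the finite sum gives pairwise overlaps, hence the quadratic form
  of the Gram operator \<open>overlap\<close>.\<close>

lemma spread_L2: "spread c \<in> L2 \<mu>" and integral_spread_sq: "(\<integral>x. (spread c x)\<^sup>2 \<partial>\<mu>) = 2 * (c \<bullet> c) - L c \<bullet> c"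
proof -
  let ?b = "\<lambda>u. c $ u / sqrt (size_of u)"
  have sq: "(spread c x)\<^sup>2 = (\<Sum>u\<in>UNIV. \<Sum>v\<in>UNIV. ?b u * ?b v * (indicator (U u) x * indicator (U v) x))" for x
    by (simp add: spread_def power2_eq_square sum_product mult_ac)
  have int: "integrable \<mu> (\<lambda>x. indicator (U u) x * indicator (U v) x :: real)" for u v
    by (rule integrable_indicator_mult) simp
  have "integrable \<mu> (\<lambda>x. (spread c x)\<^sup>2)"
    unfolding sq by (intro Bochner_Integration.integrable_sum integrable_mult_right int)
  moreover have "spread c \<in> borel_measurable \<mu>" by (simp add: spread_def[abs_def])
  ultimately show "spread c \<in> L2 \<mu>" by (simp add: L2_def)
  have "(\<integral>x. (spread c x)\<^sup>2 \<partial>\<mu>) = (\<Sum>u\<in>UNIV. \<Sum>v\<in>UNIV. ?b u * ?b v * measure \<mu> (U u \<inter> U v))"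
    unfolding sq using int by (simp add: integral_indicator_inter)
  also have "\<dots> = overlap c \<bullet> c"
    by (subst sum.swap) (simp add: overlap_def inner_vec_def sum_distrib_right sum_distrib_left mult_ac)
  also have "\<dots> = 2 * (c \<bullet> c) - L c \<bullet> c" by (simp add: laplacian_eq inner_simps)
  finally show "(\<integral>x. (spread c x)\<^sup>2 \<partial>\<mu>) = 2 * (c \<bullet> c) - L c \<bullet> c" .
qed

lemma integrable_U: "f \<in> L2 \<mu> \<Longrightarrow> integrable \<mu> (\<lambda>x. indicator (U v) x * f x)"
  by (rule integrable_mult_of_squares[OF indicator_L2])

lemma integral_mult_spread:
  assumes "f \<in> L2 \<mu>"
  shows "(\<integral>x. f x * spread c x \<partial>\<mu>) = averages f \<bullet> c"
proof -
  have "(\<integral>x. f x * spread c x \<partial>\<mu>) =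
      (\<integral>x. (\<Sum>v\<in>UNIV. c $ v / sqrt (size_of v) * (indicator (U v) x * f x)) \<partial>\<mu>)"
    by (simp add: spread_def sum_distrib_left mult_ac)
  also have "\<dots> = (\<Sum>v\<in>UNIV. c $ v / sqrt (size_of v) * (\<integral>x. indicator (U v) x * f x \<partial>\<mu>))"
    using integrable_U[OF assms] by simp
  also have "\<dots> = averages f \<bullet> c"
    by (simp add: averages_def inner_vec_def mult_ac)
  finally show ?thesis .
qed

lemma averages_inner_sq_le:
  assumes "f \<in> L2 \<mu>"
  shows "(averages f \<bullet> c)\<^sup>2 \<le> (\<integral>x. (f x)\<^sup>2 \<partial>\<mu>) * (2 * (c \<bullet> c) - L c \<bullet> c)"
  using Cauchy_Schwarz_integral[OF assms spread_L2, of c]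
  by (simp only: integral_mult_spread[OF assms] integral_spread_sq)

text \<open>The gap between the two sides is the squared norm of \<open>spread c\<close>. Hence no
  eigenvalue of \<open>L\<close> exceeds 2.\<close>

lemma laplacian_le_2: "L c \<bullet> c \<le> 2 * (c \<bullet> c)"
proof -
  have "0 \<le> (\<integral>x. (spread c x)\<^sup>2 \<partial>\<mu>)" by simp
  then show ?thesis by (simp add: integral_spread_sq)
qed

lemma averages_sum:
  assumes "\<And>i. i \<in> I \<Longrightarrow> b i \<in> L2 \<mu>"
  shows "averages (\<lambda>x. \<Sum>i\<in>I. a i * b i x) = (\<Sum>i\<in>I. a i *\<^sub>R averages (b i))"
unfolding vec_eq_iff
proof
  fix v
  have "(\<integral>x. indicator (U v) x * (\<Sum>i\<in>I. a i * b i x) \<partial>\<mu>) =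
      (\<integral>x. (\<Sum>i\<in>I. a i * (indicator (U v) x * b i x)) \<partial>\<mu>)"
    by (simp add: sum_distrib_left mult_ac)
  also have "\<dots> = (\<Sum>i\<in>I. a i * (\<integral>x. indicator (U v) x * b i x \<partial>\<mu>))"
    using integrable_U[OF assms] by simp
  finally show "averages (\<lambda>x. \<Sum>i\<in>I. a i * b i x) $ v = (\<Sum>i\<in>I. a i *\<^sub>R averages (b i)) $ v"
    by (simp add: averages_def sum_divide_distrib)
qed

section \<open>From Neumann values to a lower bound for the energy\<close>

text \<open>The difference is the integral over \<open>U v\<close> of the squared deviation of
  \<open>f\<close> from its mean: dividing by the square root of the measure in
  \<open>averages\<close> makes its square exactly the mean's share of the second moment.\<close>

lemma poincare:
  assumes f: "f \<in> global_functions M" "f \<in> L2 \<mu>" and \<eta>: "0 < \<eta>" "ennreal \<eta> \<le> neumann_value M (U v)"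
  shows "0 \<le> (\<integral>x. indicator (U v) x * (f x)\<^sup>2 \<partial>\<mu>) - (averages f $ v)\<^sup>2"
    and "ennreal (\<eta> * ((\<integral>x. indicator (U v) x * (f x)\<^sup>2 \<partial>\<mu>) - (averages f $ v)\<^sup>2)) \<le> energy M (U v) f"
proof -
  define I where "I = (\<integral>x. indicator (U v) x * f x \<partial>\<mu>)"
  define a where "a = I / size_of v"
  define h where "h = (\<lambda>x. f x - a)"
  define D where "D = (\<integral>x. indicator (U v) x * (h x)\<^sup>2 \<partial>\<mu>)"
  have fm [measurable]: "f \<in> borel_measurable \<mu>" and f2: "integrable \<mu> (\<lambda>x. (f x)\<^sup>2)"
    using f(2) by (auto simp: L2_def)
  have hm [measurable]: "h \<in> borel_measurable \<mu>" by (simp add: h_def)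
  have int_f: "integrable \<mu> (\<lambda>x. indicator (U v) x * f x)" by (rule integrable_U[OF f(2)])
  have int_f2: "integrable \<mu> (\<lambda>x. indicator (U v) x * (f x)\<^sup>2)" by (rule integrable_indicator_mult[OF f2])
  have h_eq: "indicator (U v) x * h x = indicator (U v) x * f x - a * indicator (U v) x" for x
    by (simp add: h_def algebra_simps)
  have h2_eq: "indicator (U v) x * (h x)\<^sup>2 =
      indicator (U v) x * (f x)\<^sup>2 - 2 * a * (indicator (U v) x * f x) + a\<^sup>2 * indicator (U v) x" for x
    by (simp add: h_def algebra_simps power2_eq_square)
  have int_h: "integrable \<mu> (\<lambda>x. indicator (U v) x * h x)"
    unfolding h_eq using int_f by simp
  have int_h2: "integrable \<mu> (\<lambda>x. indicator (U v) x * (h x)\<^sup>2)"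
    unfolding h2_eq using int_f int_f2 by simp
  have meas: "(\<integral>x. indicator (U v) x \<partial>\<mu>) = size_of v"
    by (simp add: size_of_def sets.Int_space_eq2)
  have "D = (\<integral>x. indicator (U v) x * (f x)\<^sup>2 \<partial>\<mu>) - 2 * a * I + a\<^sup>2 * size_of v"
    unfolding D_def h2_eq I_def meas[symmetric] using int_f int_f2 by simp
  also have "\<dots> = (\<integral>x. indicator (U v) x * (f x)\<^sup>2 \<partial>\<mu>) - (averages f $ v)\<^sup>2"
    using size_pos[of v]
    by (simp add: averages_def I_def[symmetric] a_def power_divide) (simp add: field_simps power2_eq_square)
  finally have D: "D = (\<integral>x. indicator (U v) x * (f x)\<^sup>2 \<partial>\<mu>) - (averages f $ v)\<^sup>2" .
  have D0: "0 \<le> D" by (simp add: D_def)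
  then show "0 \<le> (\<integral>x. indicator (U v) x * (f x)\<^sup>2 \<partial>\<mu>) - (averages f $ v)\<^sup>2" by (simp add: D)
  have "ennreal (\<eta> * D) \<le> energy M (U v) h"
  \<comment> \<open>If \<open>D = 0\<close>, the shifted function vanishes almost everywhere on
    \<open>U v\<close> and is no admissible test function, but the bound is then trivial.\<close>
  proof (cases "D = 0")
    case False
    let ?R = "restrict_space \<mu> (U v)"
    have UM: "U v \<inter> space \<mu> \<in> sets \<mu>" by simp
    have int: "integrable ?R g \<longleftrightarrow> integrable \<mu> (\<lambda>x. indicator (U v) x * g x)"
      "integral\<^sup>L ?R g = (\<integral>x. indicator (U v) x * g x \<partial>\<mu>)" for g :: "'a \<Rightarrow> real"
      using integrable_restrict_space[OF UM, of g] integral_restrict_space[OF UM, of g] by simp_all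
    have "h \<in> borel_measurable ?R" by (rule measurable_restrict_space1) simp
    then have hL2: "h \<in> L2 ?R" using int_h2 by (simp add: L2_def int(1))
    have "\<not> (AE x in ?R. h x = 0)"
    proof
      assume "AE x in ?R. h x = 0"
      then have "integral\<^sup>L ?R (\<lambda>x. (h x)\<^sup>2) = 0"
        by (intro integral_eq_zero_AE) auto
      then show False using False by (simp add: int(2) D_def)
    qed
    \<comment> \<open>The extension to the closure is \<open>h\<close> itself, which is continuous
      on the whole space.\<close>
    moreover have "\<exists>h'. continuous_map (subtopology (points M) (points M closure_of (U v))) euclideanreal h' \<and>
        (\<forall>x\<in>U v. h' x = h x)"
      using global_continuous[OF f(1)]
      by (intro exI[of _ h]) (auto simp: h_def intro!: continuous_intros continuous_map_from_subtopology)
    moreover have "(\<integral>x. indicator (U v) x * h x \<partial>\<mu>) = 0"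
      unfolding h_eq using int_f size_pos[of v] by (simp add: I_def[symmetric] a_def size_of_def[symmetric])
    then have "has_bochner_integral ?R h 0"
      using int_h by (simp add: has_bochner_integral_iff int)
    ultimately have "neumann_value M (U v) \<le> rayleigh M (U v) h"
      unfolding neumann_value_def using hL2 local_shift[OF f(1) open_U, of a v]
      by (intro INF_lower) (simp add: h_def)
    then have "ennreal \<eta> \<le> energy M (U v) h / ennreal D"
    proof -
      have "(\<integral>\<^sup>+x\<in>U v. ennreal ((h x)\<^sup>2) \<partial>\<mu>) = (\<integral>\<^sup>+x. ennreal (indicator (U v) x * (h x)\<^sup>2) \<partial>\<mu>)"
        by (intro nn_integral_cong) (auto split: split_indicator)
      also have "\<dots> = ennreal D" unfolding D_def by (rule nn_integral_eq_integral[OF int_h2]) simp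
      finally show ?thesis
        using \<eta>(2) \<open>neumann_value M (U v) \<le> rayleigh M (U v) h\<close> by (simp add: rayleigh_def)
    qed
    then have "ennreal \<eta> * ennreal D \<le> energy M (U v) h / ennreal D * ennreal D"
      by (rule mult_right_mono) simp
    also have "\<dots> = energy M (U v) h"
      using False D0 by (simp add: ennreal_divide_times ennreal_times_divide ennreal_mult_divide_eq)
    finally show ?thesis using \<eta>(1) D0 by (simp add: ennreal_mult)
  qed simp
  then show "ennreal (\<eta> * ((\<integral>x. indicator (U v) x * (f x)\<^sup>2 \<partial>\<mu>) - (averages f $ v)\<^sup>2)) \<le> energy M (U v) f"
    by (simp add: D h_def energy_shift)
qed

lemma energy_ge:
  assumes f: "f \<in> global_functions M" "f \<in> L2 \<mu>"
    and \<eta>: "0 < \<eta>" "\<And>v. ennreal \<eta> \<le> neumann_value M (U v)"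
  shows "ennreal (\<eta> * (2 * (\<integral>x. (f x)\<^sup>2 \<partial>\<mu>) - averages f \<bullet> averages f)) \<le>
    2 * energy M (topspace (points M)) f"
proof -
  let ?d = "\<lambda>v. (\<integral>x. indicator (U v) x * (f x)\<^sup>2 \<partial>\<mu>) - (averages f $ v)\<^sup>2"
  note p = poincare[OF f \<eta>]
  have "integrable \<mu> (\<lambda>x. (f x)\<^sup>2)" using f(2) by (simp add: L2_def)
  from sum_integral_U[OF this]
  have "(\<Sum>v\<in>UNIV. ?d v) = 2 * (\<integral>x. (f x)\<^sup>2 \<partial>\<mu>) - averages f \<bullet> averages f"
    by (simp add: sum_subtractf inner_vec_def power2_eq_square)
  then have "ennreal (\<eta> * (2 * (\<integral>x. (f x)\<^sup>2 \<partial>\<mu>) - averages f \<bullet> averages f)) = ennreal (\<Sum>v\<in>UNIV. \<eta> * ?d v)"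
    by (simp add: sum_distrib_left[symmetric])
  also have "\<dots> = (\<Sum>v\<in>UNIV. ennreal (\<eta> * ?d v))"
    \<comment> \<open>Since \<open>ennreal\<close> truncates negative numbers, it commutes with the
      sum because each summand is nonnegative.\<close>
    using p(1) \<eta>(1) by (intro sum_ennreal[symmetric]) (simp add: less_imp_le)
  also have "\<dots> \<le> (\<Sum>v\<in>UNIV. energy M (U v) f)" by (intro sum_mono p(2))
  also have "\<dots> \<le> 2 * energy M (topspace (points M)) f" by (rule energy_two_fold)
  finally show ?thesis .
qed

lemma eigenvalue_lower_bound:
  assumes \<eta>: "0 < \<eta>" "\<And>v. ennreal \<eta> \<le> neumann_value M (U v)" and k: "k < CARD('v)"
  shows "ennreal (eigenvalue_list L ! k * \<eta> / 2) \<le> eigenvalue M k"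
  unfolding eigenvalue_def
proof (rule INF_greatest)
  let ?t = "eigenvalue_list L ! k"
  note nth = eigenvalue_list_nth[OF linear_laplacian laplacian_selfadjoint k]
  fix \<Lambda> assume "\<Lambda> \<in> {\<Lambda>. L2_subspace \<mu> (k + 1) \<Lambda> \<and> \<Lambda> \<subseteq> global_functions M}"
  then obtain b where \<Lambda>: "\<Lambda> = {(\<lambda>x. \<Sum>i<k+1. a i * b i x) | a. True}"
    and indep: "\<And>a. (AE x in \<mu>. (\<Sum>i<k+1. a i * b i x) = 0) \<Longrightarrow> (\<forall>i<k+1. a i = 0)"
    and sub: "\<Lambda> \<subseteq> L2 \<mu>" "\<Lambda> \<subseteq> global_functions M"
    by (auto simp: L2_subspace_def)
  \<comment> \<open>\<open>L2_subspace\<close> states integrability for the span only; Kronecker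
    coefficients recover the spanning functions.\<close>
  have b: "b i \<in> L2 \<mu>" if "i \<in> {..<k+1}" for i
  proof -
    have "b i = (\<lambda>x. \<Sum>j<k+1. (if j = i then 1 else 0) * b j x)"
      using that by (auto simp: fun_eq_iff less_Suc_eq if_distrib[of "\<lambda>c. c * _"] cong: if_cong)
    then have "b i \<in> \<Lambda>" unfolding \<Lambda> by (intro CollectI exI[of _ "\<lambda>j. if j = i then 1 else 0"]) simp
    then show ?thesis using sub by blast
  qed
  have "dim (\<Union>s\<in>{s. s < ?t}. eigenspace L s) < k + 1" using nth(2) by simp
  then obtain a where a: "\<exists>i<k+1. a i \<noteq> 0" and
    orth: "\<And>x. x \<in> (\<Union>s\<in>{s. s < ?t}. eigenspace L s) \<Longrightarrow> x \<bullet> (\<Sum>i<k+1. a i *\<^sub>R averages (b i)) = 0"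
    by (rule orthogonal_combination_exists[of _ _ "\<lambda>i. averages (b i)"]) blast
  define f where "f = (\<lambda>x. \<Sum>i<k+1. a i * b i x)"
  define c where "c = averages f"
  have c: "c = (\<Sum>i<k+1. a i *\<^sub>R averages (b i))" unfolding c_def f_def by (rule averages_sum[OF b])
  have f: "f \<in> \<Lambda>" unfolding f_def \<Lambda> by blast
  then have fL2: "f \<in> L2 \<mu>" and fG: "f \<in> global_functions M" using sub by auto
  have f0: "\<not> (AE x in \<mu>. f x = 0)"
  proof
    assume "AE x in \<mu>. f x = 0"
    then have "AE x in \<mu>. (\<Sum>i<k+1. a i * b i x) = 0" by (simp only: f_def)
    from indep[OF this] a show False by blast
  qed
  have int: "integrable \<mu> (\<lambda>x. (f x)\<^sup>2)" using fL2 by (simp add: L2_def)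
  define F where "F = (\<integral>x. (f x)\<^sup>2 \<partial>\<mu>)"
  have "F \<noteq> 0"
    using f0 integral_nonneg_eq_0_iff_AE[OF int] by (simp add: F_def)
  moreover have "F \<ge> 0" by (simp add: F_def)
  ultimately have F: "F > 0" by simp
  have "?t * (c \<bullet> c) \<le> L c \<bullet> c"
    by (rule eigenspace_complement[OF linear_laplacian laplacian_selfadjoint, where R = "{s. s < ?t}"])
      (unfold c, rule orth, auto)
  then have "F * (2 * (c \<bullet> c) - L c \<bullet> c) \<le> F * ((2 - ?t) * (c \<bullet> c))"
    using F by (intro mult_left_mono) (auto simp: algebra_simps)
  moreover have "(c \<bullet> c)\<^sup>2 \<le> F * (2 * (c \<bullet> c) - L c \<bullet> c)"
    using averages_inner_sq_le[OF fL2, of c] by (simp only: c_def F_def)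
  ultimately have "(c \<bullet> c) * (c \<bullet> c) \<le> (2 - ?t) * F * (c \<bullet> c)" by (simp add: power2_eq_square mult_ac)
  \<comment> \<open>Needed when \<open>c = 0\<close>: then \<open>c \<bullet> c\<close> cannot be
    cancelled and the claim reads \<open>0 \<le> (2 - ?t) * F\<close>.\<close>
  moreover have "?t \<le> 2"
  proof -
    obtain x where x: "x \<in> eigenspace L ?t" "x \<noteq> 0"
      using nth(1) subspace_0[OF subspace_eigenspace[OF linear_laplacian]] by blast
    then have "?t * (x \<bullet> x) \<le> 2 * (x \<bullet> x)" using laplacian_le_2[of x] by (simp add: eigenspace_def)
    then show ?thesis using x(2) by (simp add: mult_le_cancel_right)
  qed
  ultimately have "c \<bullet> c \<le> (2 - ?t) * F"
    using F by (cases "c = 0") (auto simp: mult_le_cancel_right)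
  then have "\<eta> * ?t * F \<le> \<eta> * (2 * F - c \<bullet> c)"
    using \<eta>(1) unfolding mult.assoc by (intro mult_left_mono) (auto simp: algebra_simps)
  then have "ennreal (\<eta> * ?t * F) \<le> ennreal (\<eta> * (2 * F - c \<bullet> c))" by (rule ennreal_leI)
  also have "\<dots> \<le> 2 * energy M (topspace (points M)) f"
    unfolding c_def F_def by (rule energy_ge[OF fG fL2 \<eta>])
  finally have le: "ennreal (\<eta> * ?t * F) \<le> 2 * energy M (topspace (points M)) f" .
  have "ennreal (?t * \<eta> / 2) \<le> rayleigh M (topspace (points M)) f"
  proof -
    have "(\<integral>\<^sup>+x\<in>topspace (points M). ennreal ((f x)\<^sup>2) \<partial>\<mu>) = (\<integral>\<^sup>+x. ennreal ((f x)\<^sup>2) \<partial>\<mu>)"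
      by (intro nn_integral_cong) (simp add: space_mass)
    also have "\<dots> = ennreal F" unfolding F_def by (rule nn_integral_eq_integral[OF int]) simp
    finally have den: "(\<integral>\<^sup>+x\<in>topspace (points M). ennreal ((f x)\<^sup>2) \<partial>\<mu>) = ennreal F" .
    have "ennreal (?t * \<eta> / 2) = ennreal (\<eta> * ?t * F) / 2 / ennreal F"
    \<comment> \<open>For negative \<open>?t\<close> both sides are 0, as \<open>ennreal\<close>
      truncates.\<close>
    proof (cases "0 \<le> ?t")
      case True
      have "ennreal (\<eta> * ?t * F) / 2 / ennreal F = ennreal (\<eta> * ?t * F / 2 / F)"
        using True \<eta>(1) F divide_ennreal[of "\<eta> * ?t * F" 2] by (simp add: divide_ennreal)
      then show ?thesis using F by (simp add: mult.commute)
    next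
      case False
      then have "?t * \<eta> / 2 \<le> 0" "\<eta> * ?t * F \<le> 0"
        using \<eta>(1) F by (auto simp: mult_le_0_iff)
      then show ?thesis by (simp add: ennreal_neg)
    qed
    also have "\<dots> \<le> (2 * energy M (topspace (points M)) f) / 2 / ennreal F"
      by (intro divide_right_mono_ennreal le)
    also have "\<dots> = rayleigh M (topspace (points M)) f"
      by (simp add: rayleigh_def den mult.commute[of 2] ennreal_mult_divide_eq)
    finally show ?thesis .
  qed
  also have "\<dots> \<le> (SUP f\<in>{f\<in>\<Lambda>. \<not> (AE x in \<mu>. f x = 0)}. rayleigh M (topspace (points M)) f)"
    using f f0 by (intro SUP_upper) simp
  finally show "ennreal (?t * \<eta> / 2) \<le> (SUP f\<in>{f\<in>\<Lambda>. \<not> (AE x in \<mu>. f x = 0)}. rayleigh M (topspace (points M)) f)" .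
qed

lemma eigenvalue_comparison:
  assumes \<eta>: "0 < \<eta>" "\<And>v. ennreal \<eta> \<le> neumann_value M (U v)" and k: "k < CARD('v)"
  shows "ereal (eigenvalue_list L ! k) \<le> 2 * (enn2ereal (eigenvalue M k) / ereal \<eta>)"
proof (cases "eigenvalue M k")
  case (real r)
  have "ennreal (eigenvalue_list L ! k * \<eta> / 2) \<le> ennreal r"
    using eigenvalue_lower_bound[OF assms] real by simp
  then have "eigenvalue_list L ! k * \<eta> / 2 \<le> r" using real(1) by (simp add: ennreal_le_iff)
  then have "eigenvalue_list L ! k \<le> 2 * (r / \<eta>)" using \<eta>(1) by (simp add: field_simps)
  then show ?thesis using real \<eta>(1) by (simp add: enn2ereal_ennreal)
next
  \<comment> \<open>An infinite eigenvalue makes the right-hand side infinite.\<close>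
  case top
  then show ?thesis using \<eta>(1) by simp
qed

end


section \<open>The three classes\<close>

lemma has_derivative_shift_iff:
  fixes f :: "'a::real_normed_vector \<Rightarrow> 'b::real_normed_vector"
  shows "((\<lambda>x. f x - a) has_derivative D) F \<longleftrightarrow> (f has_derivative D) F"
  using has_derivative_diff[OF _ has_derivative_const[of a F], of f D]
    has_derivative_add[OF _ has_derivative_const[of a F], of "\<lambda>x. f x - a" D] by auto

text \<open>Holds also where \<open>f\<close> is not differentiable, since both sides choose from
  the same predicate.\<close>

lemma frechet_derivative_shift:
  "frechet_derivative (\<lambda>x. f x - a) F = frechet_derivative f F"
  by (simp add: frechet_derivative_def has_derivative_shift_iff)

lemma has_field_derivative_shift_iff:
  "((\<lambda>x. f x - a) has_field_derivative D) F \<longleftrightarrow> (f has_field_derivative D) F"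
  by (simp add: has_field_derivative_def has_derivative_shift_iff)

lemma differentiable_on_shift_iff:
  "(\<lambda>x. f x - a) differentiable_on W \<longleftrightarrow> f differentiable_on W"
  by (simp add: differentiable_on_def differentiable_def has_derivative_shift_iff)

lemma Ck_on_shift: "Ck_on k f W \<Longrightarrow> Ck_on k (\<lambda>x. f x - a) W"
  by (cases k) (auto simp: frechet_derivative_shift differentiable_on_shift_iff intro: continuous_intros)

lemma smooth_on_shift:
  assumes "smooth_on S f" "T \<subseteq> S"
  shows "smooth_on T (\<lambda>x. f x - a)"
  unfolding smooth_on_def
proof
  fix x assume "x \<in> T"
  with assms obtain W h where "open W" "x \<in> W" "\<And>k. Ck_on k h W" "\<And>y. y \<in> S \<inter> W \<Longrightarrow> h y = f y"
    by (force simp: smooth_on_def)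
  then show "\<exists>W h. open W \<and> x \<in> W \<and> (\<forall>k. Ck_on k h W) \<and> (\<forall>y\<in>T \<inter> W. h y = f y - a)"
    using assms(2) by (intro exI[of _ W] exI[of _ "\<lambda>x. h x - a"]) (auto intro: Ck_on_shift)
qed

lemma smooth_on_imp_continuous_on:
  assumes "smooth_on S f"
  shows "continuous_on S f"
  unfolding continuous_on_eq_continuous_within
proof
  fix x assume x: "x \<in> S"
  with assms obtain W h where W: "open W" "x \<in> W" and h: "\<forall>k. Ck_on k h W" "\<forall>y\<in>S \<inter> W. h y = f y"
    unfolding smooth_on_def by blast
  have "continuous_on W h" using h(1)[rule_format, of 0] by simp
  then have "continuous_on (S \<inter> W) f"
    using h(2) by (auto intro: continuous_on_eq continuous_on_subset)
  then have "continuous (at x within S \<inter> W) f"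
    using x W(2) by (simp add: continuous_on_eq_continuous_within)
  moreover have "at x within S \<inter> W = at x within S"
    using W by (intro at_within_nhd[of x W]) auto
  ultimately show "continuous (at x within S) f" by simp
qed

lemma smooth_functions_shift:
  assumes "f \<in> smooth_functions A V" "W \<subseteq> V"
  shows "(\<lambda>x. f x - a) \<in> smooth_functions A W"
  unfolding smooth_functions_def mem_Collect_eq
proof
  fix c assume "c \<in> A"
  then have "smooth_on (coord c ` (dom_of c \<inter> V)) (f \<circ> param c)"
    using assms(1) by (simp add: smooth_functions_def)
  from smooth_on_shift[OF this, of "coord c ` (dom_of c \<inter> W)" a] assms(2)
  show "smooth_on (coord c ` (dom_of c \<inter> W)) ((\<lambda>x. f x - a) \<circ> param c)"
    by (auto simp: comp_def)
qed

text \<open>On a chart domain \<open>f\<close> is its coordinate expression composed with the chart,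
  both continuous; the open chart domains are then pasted.\<close>

lemma smooth_functions_continuous_map:
  assumes X: "smooth_manifold H X A" and f: "f \<in> smooth_functions A (topspace X)"
  shows "continuous_map X euclideanreal f"
proof (rule pasting_lemma[where I = A and T = dom_of and f = "\<lambda>_. f"])
  fix c assume c: "c \<in> A"
  have chart: "chart_on H X c" using X c by (simp add: smooth_manifold_def)
  then show op: "openin X (dom_of c)" by (simp add: chart_on_def)
  have dom: "dom_of c \<inter> topspace X = dom_of c" using openin_subset[OF op] by blast
  have hom: "homeomorphic_map (subtopology X (dom_of c)) (top_of_set (range_of c)) (coord c)"
    using chart by (simp add: chart_on_def)
  have "smooth_on (range_of c) (f \<circ> param c)"
    using bspec[OF f[unfolded smooth_functions_def mem_Collect_eq] c] by (simp only: dom)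
  then have "continuous_map (top_of_set (range_of c)) euclideanreal (f \<circ> param c)"
    by (simp only: continuous_map_iff_continuous smooth_on_imp_continuous_on)
  from continuous_map_compose[OF homeomorphic_imp_continuous_map[OF hom] this]
  show "continuous_map (subtopology X (dom_of c)) euclideanreal f"
  proof (rule continuous_map_eq)
    fix x assume "x \<in> topspace (subtopology X (dom_of c))"
    moreover have "inj_on (coord c) (dom_of c)"
      using homeomorphic_imp_injective_map[OF hom] dom by (simp add: Int_commute)
    ultimately show "((f \<circ> param c) \<circ> coord c) x = f x"
      by (simp add: param_def)
  qed
next
  fix x assume "x \<in> topspace X"
  moreover have "(\<Union>c\<in>A. dom_of c) = topspace X" using X by (simp add: smooth_manifold_def)
  ultimately show "\<exists>c. c \<in> A \<and> x \<in> dom_of c \<and> f x = f x" by blast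
qed auto

lemma grad_norm_sq_shift: "grad_norm_sq A g (\<lambda>x. f x - a) = grad_norm_sq A g f"
  by (simp add: fun_eq_iff grad_norm_sq_def gradient_def comp_def frechet_derivative_shift)

lemma openin_borel_sets: "openin X W \<Longrightarrow> W \<in> borel_sets X"
  by (simp add: borel_sets_def sigma_sets.Basic)

lemma class_C1_two_fold:
  assumes M: "class_C1 M A g" and cover: "two_fold_cover (points M) (mass M) U"
  shows "two_fold_dirichlet M U"
proof
  note M = M[unfolded class_C1_def riemannian_measure_def]
  have E: "energy M W f = (\<integral>\<^sup>+x\<in>W. ennreal (grad_norm_sq A g f x) \<partial>mass M)" for W f
    using M by simp
  show "W \<in> sets (mass M)" if "openin (points M) W" for W using M that by (simp add: openin_borel_sets)
  show "space (mass M) = topspace (points M)" using M by simp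
  show "two_fold_cover (points M) (mass M) U" by (rule cover)
  show "continuous_map (points M) euclideanreal f" if "f \<in> global_functions M" for f
    using M that by (auto intro: smooth_functions_continuous_map)
  show "(\<lambda>x. f x - a) \<in> local_functions M W" if "f \<in> global_functions M" "openin (points M) W" for f a W
    using M that smooth_functions_shift[OF _ openin_subset[OF that(2)], of f A a] by simp
  show "energy M W (\<lambda>x. f x - a) = energy M W f" for W f a
    by (simp add: E grad_norm_sq_shift)
  show "(\<Sum>v\<in>UNIV. energy M (U v) f) \<le> 2 * energy M (topspace (points M)) f" for f
    unfolding E
  proof (rule nn_integral_two_fold_le)
    show "AE x in mass M. x \<in> topspace (points M) \<longrightarrow> card {v. x \<in> U v} \<le> 2"
      using cover by (auto simp: two_fold_cover_def)
  qed (use cover openin_subset in \<open>auto simp: two_fold_cover_def\<close>)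
qed

text \<open>The energy is integrated against \<open>area\<close>, so its two-fold bound rests on the
  multiplicity condition for \<open>area\<close>, not on the one for the mass.\<close>

lemma class_C2_two_fold:
  assumes M: "class_C2 M A \<C> g area" and area: "AE x in area. card {v. x \<in> U v} \<le> 2"
    and cover: "two_fold_cover (points M) (mass M) U"
  shows "two_fold_dirichlet M U"
proof
  note M = M[unfolded class_C2_def radon_measure_def]
  have E: "energy M W f = (\<integral>\<^sup>+x\<in>W. ennreal (grad_norm_sq A g f x) \<partial>area)" for W f
    using M by simp
  show "W \<in> sets (mass M)" if "openin (points M) W" for W using M that by (simp add: openin_borel_sets)
  show "space (mass M) = topspace (points M)" using M by simp
  show "two_fold_cover (points M) (mass M) U" by (rule cover)
  show "continuous_map (points M) euclideanreal f" if "f \<in> global_functions M" for f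
    using M that by (auto intro: smooth_functions_continuous_map)
  show "(\<lambda>x. f x - a) \<in> local_functions M W" if "f \<in> global_functions M" "openin (points M) W" for f a W
    using M that smooth_functions_shift[OF _ openin_subset[OF that(2)], of f A a] by simp
  show "energy M W (\<lambda>x. f x - a) = energy M W f" for W f a
    by (simp add: E grad_norm_sq_shift)
  show "(\<Sum>v\<in>UNIV. energy M (U v) f) \<le> 2 * energy M (topspace (points M)) f" for f
    unfolding E
  proof (rule nn_integral_two_fold_le)
    show "AE x in area. x \<in> topspace (points M) \<longrightarrow> card {v. x \<in> U v} \<le> 2"
      using area by auto
  qed (use cover openin_subset in \<open>auto simp: two_fold_cover_def\<close>)
qed

lemma C2_on_shift:
  assumes "C2_on S h" "T \<subseteq> S"
  shows "C2_on T (\<lambda>t. h t - a)"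
proof -
  obtain h' h'' where h: "\<forall>t\<in>S. (h has_real_derivative h' t) (at t within S) \<and>
      (h' has_real_derivative h'' t) (at t within S)" "continuous_on S h''"
    using assms(1) by (auto simp: C2_on_def)
  show ?thesis unfolding C2_on_def has_field_derivative_shift_iff
    using h assms(2)
    by (intro exI[of _ h'] exI[of _ h'']) (blast intro: DERIV_subset continuous_on_subset)
qed

lemma piecewise_C2_on_shift:
  assumes f: "piecewise_C2_on G \<l> \<phi> V f" and W: "W \<subseteq> V"
  shows "piecewise_C2_on G \<l> \<phi> W (\<lambda>x. f x - a)"
  unfolding piecewise_C2_on_def
proof
  fix e assume "e \<in> arcs G"
  with f obtain P where P: "finite P" "{0, \<l> e} \<subseteq> P" "P \<subseteq> {0..\<l> e}"
    and C2: "\<And>b c. b \<in> P \<Longrightarrow> c \<in> P \<Longrightarrow> b < c \<and> {b<..<c} \<inter> P = {} \<Longrightarrow>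
      C2_on {t\<in>{b..c}. \<phi> e t \<in> V} (f \<circ> \<phi> e)"
    unfolding piecewise_C2_on_def by meson
  have "C2_on {t\<in>{b..c}. \<phi> e t \<in> W} ((\<lambda>x. f x - a) \<circ> \<phi> e)"
    if "b \<in> P" "c \<in> P" "b < c \<and> {b<..<c} \<inter> P = {}" for b c
    using C2_on_shift[OF C2[OF that], of "{t\<in>{b..c}. \<phi> e t \<in> W}" a] W by (auto simp: comp_def)
  with P show "\<exists>P. finite P \<and> {0, \<l> e} \<subseteq> P \<and> P \<subseteq> {0..\<l> e} \<and> (\<forall>b\<in>P. \<forall>c\<in>P. b < c \<and> {b<..<c} \<inter> P = {} \<longrightarrow>
      C2_on {t\<in>{b..c}. \<phi> e t \<in> W} ((\<lambda>x. f x - a) \<circ> \<phi> e))"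
    by (intro exI[of _ P]) blast
qed

section \<open>Metric graphs: from the graph to its edges\<close>

text \<open>Induction over the generated sigma-algebra: the quotient topology makes preimages of
  open sets relatively open, and complements are taken within the edge interval, which is mapped
  into the space.\<close>

lemma edge_preimage_borel:
  assumes X: "metric_graph X G \<l> \<phi>" and e: "e \<in> arcs G" and N: "N \<in> borel_sets X"
  shows "{t\<in>{0..\<l> e}. \<phi> e t \<in> N} \<in> sets borel"
  using N unfolding borel_sets_def
proof induction
  case (Basic W)
  then have "W \<subseteq> topspace X" "openin X W" using openin_subset by auto
  then have "openin (top_of_set {0..\<l> e}) {t\<in>{0..\<l> e}. \<phi> e t \<in> W}"
    using X e unfolding metric_graph_def by blast
  then obtain V where "open V" "{t\<in>{0..\<l> e}. \<phi> e t \<in> W} = {0..\<l> e} \<inter> V"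
    by (auto simp: openin_open)
  then show ?case by simp
next
  case Empty
  then show ?case by simp
next
  case (Compl N)
  have "\<phi> e t \<in> topspace X" if "t \<in> {0..\<l> e}" for t
    using X e that unfolding metric_graph_def by blast
  then have "{t\<in>{0..\<l> e}. \<phi> e t \<in> topspace X - N} = {0..\<l> e} - {t\<in>{0..\<l> e}. \<phi> e t \<in> N}" by blast
  then show ?case using Compl.IH by simp
next
  case (Union N)
  have "{t\<in>{0..\<l> e}. \<phi> e t \<in> (\<Union>i. N i)} = (\<Union>i. {t\<in>{0..\<l> e}. \<phi> e t \<in> N i})" by blast
  then show ?case using Union.IH by simp
qed

text \<open>The measure of an exceptional null set is a finite sum over the edges, so each summand
  vanishes. This carries the multiplicity of the cover over to Lebesgue measure on an edge.\<close>

lemma AE_edge: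
  assumes X: "metric_graph X G \<l> \<phi>" and \<mu>: "graph_lebesgue_measure X G \<l> \<phi> \<mu>"
    and e: "e \<in> arcs G" and P: "AE x in \<mu>. P x"
  shows "AE t in lborel. t \<in> {0..\<l> e} \<longrightarrow> P (\<phi> e t)"
proof -
  obtain N where N: "{x \<in> space \<mu>. \<not> P x} \<subseteq> N" "emeasure \<mu> N = 0" "N \<in> sets \<mu>"
    using P by (rule AE_E)
  have "finite (arcs G)" using X by (simp add: metric_graph_def fin_digraph.finite_arcs)
  moreover have "emeasure \<mu> N = (\<Sum>e\<in>arcs G. emeasure lborel {t\<in>{0..\<l> e}. \<phi> e t \<in> N})"
    using \<mu> N(3) by (simp add: graph_lebesgue_measure_def)
  ultimately have "emeasure lborel {t\<in>{0..\<l> e}. \<phi> e t \<in> N} = 0"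
    using N(2) e by simp
  moreover have "{t\<in>{0..\<l> e}. \<phi> e t \<in> N} \<in> sets borel"
    using edge_preimage_borel[OF X e] N(3) \<mu> by (simp add: graph_lebesgue_measure_def)
  ultimately have "{t\<in>{0..\<l> e}. \<phi> e t \<in> N} \<in> null_sets lborel" by (auto simp: null_sets_def)
  moreover have "\<phi> e t \<in> space \<mu>" if "t \<in> {0..\<l> e}" for t
    using X \<mu> e that unfolding metric_graph_def graph_lebesgue_measure_def by blast
  ultimately show ?thesis
    using N(1) by (intro AE_I'[of "{t\<in>{0..\<l> e}. \<phi> e t \<in> N}"]) auto
qed

lemma class_C3_two_fold:
  assumes M: "class_C3 M G \<l> \<phi>" and cover: "two_fold_cover (points M) (mass M) U"
  shows "two_fold_dirichlet M U"
proof
  have X: "metric_graph (points M) G \<l> \<phi>" and \<mu>: "graph_lebesgue_measure (points M) G \<l> \<phi> (mass M)"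
    and global: "global_functions M = Zh (points M) G \<l> \<phi>"
    and loc: "local_functions M = (\<lambda>U. {f. continuous_map (subtopology (points M) U) euclideanreal f \<and>
       piecewise_C2_on G \<l> \<phi> U f})"
    and E: "energy M = (\<lambda>U f. \<Sum>e\<in>arcs G. \<integral>\<^sup>+t\<in>{t\<in>{0..\<l> e}. \<phi> e t \<in> U}.
       ennreal ((deriv (f \<circ> \<phi> e) t)\<^sup>2) \<partial>lborel)"
    using M by (simp_all add: class_C3_def)
  show "W \<in> sets (mass M)" if "openin (points M) W" for W
    using \<mu> that by (simp add: graph_lebesgue_measure_def openin_borel_sets)
  show "space (mass M) = topspace (points M)" using \<mu> by (simp add: graph_lebesgue_measure_def)
  show "two_fold_cover (points M) (mass M) U" by (rule cover)
  show cont: "continuous_map (points M) euclideanreal f" if "f \<in> global_functions M" for f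
    using that by (simp add: global Zh_def)
  show "(\<lambda>x. f x - a) \<in> local_functions M W" if "f \<in> global_functions M" "openin (points M) W" for f a W
  proof -
    have "continuous_map (subtopology (points M) W) euclideanreal (\<lambda>x. f x - a)"
      using cont[OF that(1)] by (intro continuous_intros continuous_map_from_subtopology)
    moreover have "piecewise_C2_on G \<l> \<phi> (topspace (points M)) f"
      using that(1) by (simp add: global Zh_def)
    ultimately show ?thesis
      using piecewise_C2_on_shift openin_subset[OF that(2)] by (simp add: loc)
  qed
  show "energy M W (\<lambda>x. f x - a) = energy M W f" for W f a
    by (simp add: E comp_def deriv_def has_field_derivative_shift_iff)
  show "(\<Sum>v\<in>UNIV. energy M (U v) f) \<le> 2 * energy M (topspace (points M)) f" for f
  proof -
    let ?I = "\<lambda>e W. \<integral>\<^sup>+t\<in>{t\<in>{0..\<l> e}. \<phi> e t \<in> W}. ennreal ((deriv (f \<circ> \<phi> e) t)\<^sup>2) \<partial>lborel"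
    \<comment> \<open>The bound is proved edge by edge for the preimages of the cover; the sums over
      edges and cover are interchanged afterwards.\<close>
    have "(\<Sum>v\<in>UNIV. ?I e (U v)) \<le> 2 * ?I e (topspace (points M))" if e: "e \<in> arcs G" for e
    proof (rule nn_integral_two_fold_le)
      have "AE x in mass M. card {v. x \<in> U v} \<le> 2"
        using cover by (auto simp: two_fold_cover_def)
      from AE_edge[OF X \<mu> e this]
      show "AE t in lborel. t \<in> {t\<in>{0..\<l> e}. \<phi> e t \<in> topspace (points M)} \<longrightarrow>
          card {v. t \<in> {t\<in>{0..\<l> e}. \<phi> e t \<in> U v}} \<le> 2"
        by eventually_elim auto
    qed (use cover openin_subset in \<open>auto simp: two_fold_cover_def\<close>)
    then have "(\<Sum>e\<in>arcs G. \<Sum>v\<in>UNIV. ?I e (U v)) \<le> (\<Sum>e\<in>arcs G. 2 * ?I e (topspace (points M)))"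
      by (rule sum_mono)
    then show ?thesis
      unfolding E by (subst sum.swap) (simp add: sum_distrib_left)
  qed
qed

theorem theorem1p2:
  fixes M :: "'a dirichlet_space"
    and A\<^sub>1 :: "('a, 'n::finite) chart set" and g\<^sub>1 :: "('a, 'n) metric"
    and A\<^sub>2 :: "('a, 2) chart set" and \<C> :: "('a, 2) metric set" and g\<^sub>2 :: "('a, 2) metric"
    and area :: "'a measure"
    and G :: "('a, 'e) pre_digraph" and \<l> :: "'e \<Rightarrow> real" and \<phi> :: "'e \<Rightarrow> real \<Rightarrow> 'a"
    and U :: "'v::finite \<Rightarrow> 'a set" and \<eta> :: real and k :: nat
  assumes "class_C1 M A\<^sub>1 g\<^sub>1 \<or>
      (class_C2 M A\<^sub>2 \<C> g\<^sub>2 area \<and> (AE x in area. card {v. x \<in> U v} \<le> 2)) \<or>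
      class_C3 M G \<l> \<phi>"
    and "two_fold_cover (points M) (mass M) U"
    and "0 < \<eta>"
    and "\<And>v. ennreal \<eta> \<le> neumann_value M (U v)"
    and "0 < k" and "k \<le> CARD('v) - 1"
  shows "ereal (eigenvalue_list (normalized_laplacian (mass M) U) ! k)
      \<le> 2 * (enn2ereal (eigenvalue M k) / ereal \<eta>)"
proof -
  have "two_fold_dirichlet M U"
    using assms(1,2) class_C1_two_fold class_C2_two_fold class_C3_two_fold by blast
  moreover have "k < CARD('v)" using assms(5,6) by simp
  ultimately show ?thesis using assms(3,4) by (intro two_fold_dirichlet.eigenvalue_comparison)
qed

end
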